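(* For every $k\ge1$, the class of all graphs admitting a tree decomposition of width at most $k$ and adhesion at most $2$ is homomorphism distinguishing closed.
   Context: All graphs are finite, simple, undirected and loopless. A tree decomposition $(T,\beta)$ of $G$ has width $\max_{t}|\beta(t)|-1$ and adhesion $\max_{tt'\in E(T)}|\beta(t)\cap\beta(t')|$. $\hom(F,G)$ is the number of homomorphisms $F\to G$; $G\equiv_{\mathcal{C}}H$ means $\hom(F,G)=\hom(F,H)$ for all $F\in\mathcal{C}$. A graph class $\mathcal{C}$ is homomorphism distinguishing closed if for every graph $F'\notin\mathcal{C}$ there exist graphs $G,H$ with $G\equiv_{\mathcal{C}}H$ and $\hom(F',G)\neq\hom(F',H)$. *)

theory Defs
  imports "Graph_Theory.Digraph_Component" "HOL-Library.FuncSet"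
begin

text \<open>
  A finite simple undirected loopless graph is a \<^locale>\<open>pair_graph\<close>: a finite, symmetric and
  irreflexive arc set on a finite vertex set. Every finite graph is isomorphic to one with vertices
  in \<^typ>\<open>nat\<close>, so graph classes are taken to be sets of graphs on \<^typ>\<open>nat\<close>.
\<close>

type_synonym ngraph = "nat pair_pre_digraph"

text \<open>
  The library's \<^const>\<open>tree\<close> is unsuitable for symmetric digraphs: it counts the closed walk
  \<open>a, b, a\<close> along an edge as a cycle. Cycles of an undirected simple graph are those
  of length at least 3.
\<close>

definition undirected_tree :: "'t pair_pre_digraph \<Rightarrow> bool" where
  "undirected_tree T \<longleftrightarrow> pair_graph T \<and> connected (with_proj T) \<and>
     \<not> (\<exists>p. pre_digraph.cycle (with_proj T) p \<and> 3 \<le> length p)"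

definition tree_decomposition ::
    "'a pair_pre_digraph \<Rightarrow> 't pair_pre_digraph \<Rightarrow> ('t \<Rightarrow> 'a set) \<Rightarrow> bool" where
  "tree_decomposition G T \<beta> \<longleftrightarrow>
     undirected_tree T \<and>
     (\<Union>t\<in>pverts T. \<beta> t) = pverts G \<and>
     (\<forall>(u, v)\<in>parcs G. \<exists>t\<in>pverts T. u \<in> \<beta> t \<and> v \<in> \<beta> t) \<and>
     (\<forall>v\<in>pverts G. connected (with_proj T \<restriction> {t \<in> pverts T. v \<in> \<beta> t}))"

text \<open>Integer-valued, since the empty graph has a decomposition of width \<open>-1\<close>.\<close>

definition td_width :: "'t pair_pre_digraph \<Rightarrow> ('t \<Rightarrow> 'a set) \<Rightarrow> int" where
  "td_width T \<beta> = Max ((\<lambda>t. int (card (\<beta> t))) ` pverts T) - 1"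

text \<open>The inserted \<open>0\<close> fixes the value for a one-node tree, where the maximum is over no edges.\<close>

definition td_adhesion :: "'t pair_pre_digraph \<Rightarrow> ('t \<Rightarrow> 'a set) \<Rightarrow> nat" where
  "td_adhesion T \<beta> = Max (insert 0 ((\<lambda>(t, t'). card (\<beta> t \<inter> \<beta> t')) ` parcs T))"

definition td_class :: "nat \<Rightarrow> nat \<Rightarrow> ngraph set" where
  "td_class k a = {G. pair_graph G \<and>
     (\<exists>(T :: ngraph) \<beta>. tree_decomposition G T \<beta> \<and> td_width T \<beta> \<le> int k \<and> td_adhesion T \<beta> \<le> a)}"

text \<open>Homomorphisms are extensional functions, so that each one is counted exactly once.\<close>

definition graph_homs :: "'a pair_pre_digraph \<Rightarrow> 'b pair_pre_digraph \<Rightarrow> ('a \<Rightarrow> 'b) set" where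
  "graph_homs F G = {f \<in> pverts F \<rightarrow>\<^sub>E pverts G. \<forall>(u, v)\<in>parcs F. (f u, f v) \<in> parcs G}"

definition hom_count :: "'a pair_pre_digraph \<Rightarrow> 'b pair_pre_digraph \<Rightarrow> nat" where
  "hom_count F G = card (graph_homs F G)"

definition hom_indistinguishable :: "ngraph set \<Rightarrow> ngraph \<Rightarrow> ngraph \<Rightarrow> bool" where
  "hom_indistinguishable C G H \<longleftrightarrow> (\<forall>F\<in>C. hom_count F G = hom_count F H)"

definition hom_distinguishing_closed :: "ngraph set \<Rightarrow> bool" where
  "hom_distinguishing_closed C \<longleftrightarrow>
     (\<forall>F'. pair_graph F' \<and> F' \<notin> C \<longrightarrow>
        (\<exists>G H. pair_graph G \<and> pair_graph H \<and> hom_indistinguishable C G H \<and>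
               hom_count F' G \<noteq> hom_count F' H))"

end

theory Submission
  imports Defs
begin

text \<open>
  Put \<open>a = min k 2\<close> and call \<open>B \<subseteq> V(F)\<close> inseparable if no \<open>A\<close> with \<open>|A| \<le> a\<close> separates two
  vertices of \<open>B - A\<close>. If \<open>F\<close> has no inseparable set of size \<open>k + 2\<close>, splitting along minimal
  separators and passing to torsos yields a decomposition of width \<open>\<le> k\<close> and adhesion \<open>\<le> a\<close>.

  Otherwise fix such a set \<open>B\<close> and \<open>v \<in> B\<close>, and compare the CFI graphs of \<open>F\<close> without a twist
  and with a twist at \<open>v\<close>. The lifts of a homomorphism \<open>h : X \<rightarrow> F\<close> to a CFI graph are the solutions
  of a linear system over the two-element field whose right-hand side is the twist, so the two
  graphs have equally many lifts of \<open>h\<close> whenever a twisted lift exists. The identity of \<open>F\<close> has no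
  twisted lift, by a handshake count. If \<open>X\<close> is in the class, a twisted lift is built bag by bag:
  the bag \<open>\<beta>(t)\<close> uses an edge set with boundary \<open>v + r(t)\<close>, where \<open>r(t) \<in> B\<close> lies outside
  \<open>h(\<beta>(t))\<close>, and the edge sets of adjacent bags differ by a path avoiding the image of their
  intersection.
\<close>

section \<open>Inseparable sets and torsos\<close>

text \<open>For order \<open>a\<close> these are the (a+1)-inseparable sets of block theory, without
  the maximality demanded of a block.\<close>

definition inseparable :: "nat \<Rightarrow> 'a rel \<Rightarrow> 'a set \<Rightarrow> bool" where
  "inseparable a E B \<longleftrightarrow>
     (\<forall>A. finite A \<and> card A \<le> a \<longrightarrow> (B - A) \<times> (B - A) \<subseteq> (Restr E (- A))\<^sup>*)"

lemma inseparableD: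
  "inseparable a E B \<Longrightarrow> finite A \<Longrightarrow> card A \<le> a \<Longrightarrow> b \<in> B - A \<Longrightarrow> b' \<in> B - A \<Longrightarrow>
    (b, b') \<in> (Restr E (- A))\<^sup>*"
  unfolding inseparable_def by blast

lemma card_le_1_eq:
  "finite A \<Longrightarrow> card A \<le> 1 \<Longrightarrow> x \<in> A \<Longrightarrow> y \<in> A \<Longrightarrow> x = y"
  using card_le_Suc0_iff_eq by auto

lemma sym_Restr_rtrancl: "sym E \<Longrightarrow> sym ((Restr E S)\<^sup>*)"
  by (intro sym_rtrancl) (auto simp: sym_def)

lemma rtrancl_lift:
  assumes "(x, y) \<in> R\<^sup>*" "R \<subseteq> S\<^sup>*"
  shows "(x, y) \<in> S\<^sup>*"
  using assms rtrancl_subset_rtrancl by blast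

text \<open>Let X have at most \<open>a\<close> vertices. If X misses D, every clique edge of A
  outside X can be replaced by a path through D. If X meets D, it uses fewer than \<open>a\<close>
  vertices of P; the vertex saved can be spent on deleting one of A, and as |A| <= 2 the clique then
  contributes nothing but loops.\<close>

lemma inseparable_torso:
  assumes sym: "sym E" and A: "finite A" "A \<subseteq> P" "card A \<le> a" "a \<le> 2"
    and B: "B \<subseteq> P" "a + 2 \<le> card B"
    and D: "D \<inter> P = {}" "D \<times> D \<subseteq> (Restr E D)\<^sup>*" "\<And>x. x \<in> A \<Longrightarrow> \<exists>d\<in>D. (x, d) \<in> E"
    and insep: "inseparable a (Restr E P \<union> A \<times> A) B"
  shows "inseparable a E B"
  unfolding inseparable_def
proof (intro allI impI subrelI)
  fix X b b' assume X: "finite X \<and> card X \<le> a" and "(b, b') \<in> (B - X) \<times> (B - X)"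
  then have b: "b \<in> B - X" "b' \<in> B - X" by auto
  let ?R = "(Restr E (- X))\<^sup>*"
  \<comment> \<open>S is what gets deleted in the torso: it must contain the part of X inside P, and
    the clique edges that survive must be realised outside X.\<close>
  have lift: "(u, w) \<in> ?R"
    if "X \<inter> P \<subseteq> S" "finite S" "card S \<le> a" "(A - S) \<times> (A - S) \<subseteq> ?R" "u \<in> B - S" "w \<in> B - S"
    for S u w
  proof -
    have "(u, w) \<in> (Restr (Restr E P \<union> A \<times> A) (- S))\<^sup>*"
      using inseparableD[OF insep] that by blast
    moreover have "Restr (Restr E P \<union> A \<times> A) (- S) \<subseteq> ?R"
      using that(1,4) by auto
    ultimately show ?thesis by (rule rtrancl_lift)
  qed
  have symR: "sym ?R" by (rule sym_Restr_rtrancl[OF sym])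
  have finXP: "finite (X \<inter> P)" and cXP: "card (X \<inter> P) \<le> card X"
    using X by (auto intro: card_mono)
  show "(b, b') \<in> ?R"
  proof (cases "D \<inter> X = {}")
    case True
    have "(x, y) \<in> ?R" if x: "x \<in> A - X" and y: "y \<in> A - X" for x y
    proof -
      obtain d d' where d: "d \<in> D" "(x, d) \<in> E" "d' \<in> D" "(y, d') \<in> E"
        using D(3) x y by blast
      have xd: "(x, d) \<in> Restr E (- X)" and dy: "(d', y) \<in> Restr E (- X)"
        using d x y True sym by (auto dest: symD)
      have "(d, d') \<in> (Restr E D)\<^sup>*" using d(1,3) D(2) by blast
      moreover have "Restr E D \<subseteq> Restr E (- X)" using True by auto
      ultimately have "(d, d') \<in> ?R" using rtrancl_mono by blast
      then show ?thesis
        by (rule converse_rtrancl_into_rtrancl[OF xd rtrancl_into_rtrancl[OF _ dy]])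
    qed
    then show ?thesis
      using X finXP cXP b B A(2) by (intro lift[of "X \<inter> P"]) auto
  next
    case False
    then have "X \<inter> P \<subset> X" using D(1) by auto
    then have less: "card (X \<inter> P) < card X" using X by (simp add: psubset_card_mono)
    show ?thesis
    proof (cases "card A \<le> 1")
      case True
      have "(A - S) \<times> (A - S) \<subseteq> ?R" for S
        using card_le_1_eq[OF A(1) True] by auto
      then show ?thesis using X finXP cXP b by (intro lift[of "X \<inter> P"]) auto
    next
      case False
      with A have cA: "card A = 2" "a = 2" by auto
      have conn: "(u, w) \<in> ?R" if c: "c \<in> A" "u \<in> B - X - {c}" "w \<in> B - X - {c}" for c u w
      proof (rule lift[of "insert c (X \<inter> P)"])
        show "card (insert c (X \<inter> P)) \<le> a"
          using card_insert_le_m1[of a "X \<inter> P" c] less X cA by (simp add: card_insert_if)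
        have "card (A - {c}) \<le> 1" using c cA A by simp
        then have "x = y" if "x \<in> A - {c}" "y \<in> A - {c}" for x y
          using card_le_1_eq[of "A - {c}"] A that by blast
        then show "(A - insert c (X \<inter> P)) \<times> (A - insert c (X \<inter> P)) \<subseteq> ?R" by blast
      qed (use that finXP in auto)
      show ?thesis
      proof (cases "A \<subseteq> {b, b'}")
        case False
        then obtain c where "c \<in> A" "c \<noteq> b" "c \<noteq> b'" by auto
        then show ?thesis using conn[of c b b'] b by auto
      next
        case True
        then have Abb: "A = {b, b'}" "b \<noteq> b'" using cA by (auto simp: card_2_iff)
        \<comment> \<open>No vertex of A differs from both endpoints, so a detour over a third
          vertex w of B is taken, deleting b' between b and w, and b between w and b'. Such a w
          exists since |B| >= 4, |A| = 2, and X, having a vertex in D, meets B at most once.\<close>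
        have "card (B \<inter> X) \<le> 1"
          using less X cA B(1) card_mono[OF finXP, of "B \<inter> X"] by fastforce
        then have "card ((B \<inter> X) \<union> A) \<le> 3"
          using card_Un_le[of "B \<inter> X" A] cA by linarith
        moreover have "finite ((B \<inter> X) \<union> A)" using X A by auto
        ultimately have "\<not> B \<subseteq> (B \<inter> X) \<union> A"
          using B(2) cA card_mono[of "(B \<inter> X) \<union> A" B] by linarith
        then obtain w where w: "w \<in> B" "w \<notin> X" "w \<notin> A" by auto
        have "(b, w) \<in> ?R" using conn[of b' b w] w b Abb by auto
        moreover have "(w, b') \<in> ?R" using conn[of b w b'] w b Abb by auto
        ultimately show ?thesis by (rule rtrancl_trans)
      qed
    qed
  qed
qed

text \<open>A tree decomposition as a list of bags with the running intersection property.\<close>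

definition bag_list :: "nat \<Rightarrow> nat \<Rightarrow> 'a set list \<Rightarrow> bool" where
  "bag_list k a Bs \<longleftrightarrow> Bs \<noteq> [] \<and> (\<forall>B\<in>set Bs. finite B \<and> card B \<le> k + 1) \<and>
     (\<forall>i. 0 < i \<and> i < length Bs \<longrightarrow>
        (\<exists>j<i. Bs ! i \<inter> \<Union>(set (take i Bs)) \<subseteq> Bs ! j \<and> card (Bs ! i \<inter> Bs ! j) \<le> a))"

text \<open>The head of \<open>Cs\<close> contains A, so it can hang below the bag B of
  \<open>Bs\<close>. Every later bag of \<open>Cs\<close> keeps its predecessor: what it shares with
  \<open>Bs\<close> lies in A, hence already in an earlier bag of \<open>Cs\<close>, the
  head.\<close>

lemma bag_list_append:
  assumes Bs: "bag_list k a Bs" and Cs: "bag_list k a Cs"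
    and int: "\<Union>(set Bs) \<inter> \<Union>(set Cs) \<subseteq> A" and A: "finite A" "card A \<le> a" "A \<subseteq> hd Cs"
    and B: "B \<in> set Bs" "A \<subseteq> B"
  shows "bag_list k a (Bs @ Cs)"
proof -
  let ?L = "Bs @ Cs"
  have Cs0: "Cs \<noteq> []" "hd Cs = Cs ! 0" using Cs by (auto simp: bag_list_def hd_conv_nth)
  have "\<exists>j<i. ?L ! i \<inter> \<Union>(set (take i ?L)) \<subseteq> ?L ! j \<and> card (?L ! i \<inter> ?L ! j) \<le> a"
    if i: "0 < i" "i < length ?L" for i
  proof (cases "i < length Bs")
    case True
    then obtain j where "j < i" "Bs ! i \<inter> \<Union>(set (take i Bs)) \<subseteq> Bs ! j" "card (Bs ! i \<inter> Bs ! j) \<le> a"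
      using Bs i unfolding bag_list_def by blast
    then show ?thesis using True by (intro exI[of _ j]) (auto simp: nth_append)
  next
    case False
    define m where "m = i - length Bs"
    have m: "i = length Bs + m" "m < length Cs" using False i by (auto simp: m_def)
    have Cm: "Cs ! m \<subseteq> \<Union>(set Cs)" using nth_mem[OF m(2)] by auto
    show ?thesis
    proof (cases "m = 0")
      case True
      obtain j where j: "j < length Bs" "Bs ! j = B" using B by (auto simp: in_set_conv_nth)
      have "Cs ! 0 \<inter> \<Union>(set Bs) \<subseteq> A" using int Cm True by auto
      moreover have "Cs ! 0 \<inter> B \<subseteq> A" using calculation B by auto
      moreover have "card (Cs ! 0 \<inter> B) \<le> a"
        using card_mono[OF A(1) calculation(2)] A(2) by linarith
      ultimately show ?thesis using True m j B(2) by (intro exI[of _ j]) (simp add: nth_append)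
    next
      case False
      then obtain j where j: "j < m" "Cs ! m \<inter> \<Union>(set (take m Cs)) \<subseteq> Cs ! j"
          "card (Cs ! m \<inter> Cs ! j) \<le> a"
        using Cs m unfolding bag_list_def by blast
      have "Cs ! 0 \<in> set (take m Cs)"
        using nth_mem[of 0 "take m Cs"] False m Cs0 by simp
      then have "A \<subseteq> \<Union>(set (take m Cs))" using A Cs0 by auto
      then have "Cs ! m \<inter> \<Union>(set Bs) \<subseteq> \<Union>(set (take m Cs))" using int Cm by auto
      then have "Cs ! m \<inter> (\<Union>(set Bs) \<union> \<Union>(set (take m Cs))) \<subseteq> Cs ! j" using j by auto
      then show ?thesis using j m
        by (intro exI[of _ "length Bs + j"]) (simp add: nth_append)
    qed
  qed
  then show ?thesis using Bs Cs unfolding bag_list_def by auto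
qed

section \<open>Components of a graph minus a separator, and recursive decomposition\<close>

abbreviation (input) comp_avoiding :: "'a rel \<Rightarrow> 'a set \<Rightarrow> 'a \<Rightarrow> 'a set" where
  "comp_avoiding E A b \<equiv> (Restr E (- A))\<^sup>* `` {b}"

lemma comp_avoiding_disjoint:
  assumes "b \<notin> A" shows "comp_avoiding E A b \<inter> A = {}"
proof -
  have "y \<notin> A" if "(b, y) \<in> (Restr E (- A))\<^sup>*" for y
    using that assms by (cases rule: rtranclE) auto
  then show ?thesis by auto
qed

lemma comp_avoiding_step:
  assumes "u \<in> comp_avoiding E A b" "b \<notin> A" "(u, w) \<in> E" "w \<notin> A"
  shows "w \<in> comp_avoiding E A b"
proof -
  have "u \<notin> A" using comp_avoiding_disjoint[OF assms(2)] assms(1) by auto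
  then show ?thesis using assms by (auto intro: rtrancl_into_rtrancl)
qed

lemma comp_avoiding_connected:
  assumes "sym E"
  shows "comp_avoiding E A b \<times> comp_avoiding E A b \<subseteq> (Restr E (comp_avoiding E A b))\<^sup>*"
proof -
  let ?D = "comp_avoiding E A b"
  have *: "(b, y) \<in> (Restr E ?D)\<^sup>*" if "(b, y) \<in> (Restr E (- A))\<^sup>*" for y
    using that
  proof (induction rule: rtrancl_induct)
    case (step y z)
    then have "(y, z) \<in> Restr E ?D" by (auto intro: rtrancl_into_rtrancl)
    with step.IH show ?case by (rule rtrancl_into_rtrancl)
  qed auto
  have "sym ((Restr E ?D)\<^sup>*)" by (rule sym_Restr_rtrancl[OF assms])
  then show ?thesis using * by (auto dest: symD intro: rtrancl_trans)
qed

text \<open>If x had no neighbour in the component of b, releasing x from A would not let a walk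
  from b leave that component, so b' would stay out of reach.\<close>

lemma minimal_separator_neighbour:
  assumes sym: "sym E" and sep: "(b, b') \<notin> (Restr E (- A))\<^sup>*" "b \<notin> A" "b' \<notin> A"
    and min: "(b, b') \<in> (Restr E (- (A - {x})))\<^sup>*" and x: "x \<in> A"
  shows "\<exists>d\<in>comp_avoiding E A b. (x, d) \<in> E"
proof (rule ccontr)
  assume no: "\<not> ?thesis"
  have "y \<in> comp_avoiding E A b" if "(b, y) \<in> (Restr E (- (A - {x})))\<^sup>*" for y
    using that
  proof (induction rule: rtrancl_induct)
    case (step y z)
    then have "z \<noteq> x" using no sym by (auto dest: symD)
    then show ?case using step comp_avoiding_step[of y E A b z] sep(2) by auto
  qed auto
  then show False using min sep by auto
qed

text \<open>Torso relations contain all of A x A, loops included, so covering their pairs covers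
  singletons too; with at most two elements a single pair is all of A.\<close>

lemma clique_covered:
  assumes "finite A" "card A \<le> 2" "Bs \<noteq> []" "\<forall>(u, w)\<in>A \<times> A. \<exists>B\<in>set Bs. u \<in> B \<and> w \<in> B"
  shows "\<exists>B\<in>set Bs. A \<subseteq> B"
proof -
  consider "card A = 0" | "card A = 1" | "card A = 2" using assms(2) by linarith
  then have "A = {} \<or> (\<exists>x y. A = {x, y})"
    using assms(1) by cases (auto simp: card_1_singleton_iff card_2_iff)
  then show ?thesis
  proof
    assume "A = {}"
    then show ?thesis using assms(3) by (intro bexI[of _ "hd Bs"]) auto
  next
    assume "\<exists>x y. A = {x, y}"
    then obtain x y where "A = {x, y}" by blast
    then show ?thesis using assms(4) by fastforce
  qed
qed

text \<open>The clique \<open>R\<close> is needed to glue two decompositions at a head bag containing the separator.\<close>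

lemma bag_list_exists:
  assumes "finite V" "sym E" "E \<subseteq> V \<times> V" "a \<le> 2" "a \<le> k"
    and "\<And>B. B \<subseteq> V \<Longrightarrow> k + 2 \<le> card B \<Longrightarrow> \<not> inseparable a E B"
    and "R \<subseteq> V" "\<forall>x\<in>R. \<forall>y\<in>R. x \<noteq> y \<longrightarrow> (x, y) \<in> E"
  shows "\<exists>Bs. bag_list k a Bs \<and> \<Union>(set Bs) = V \<and>
    (\<forall>(u, w)\<in>E. \<exists>B\<in>set Bs. u \<in> B \<and> w \<in> B) \<and> R \<subseteq> hd Bs"
  using assms(1-3,6-8)
proof (induction "card V" arbitrary: V E R rule: less_induct)
  case less
  note fin = \<open>finite V\<close> and sym = \<open>sym E\<close> and EV = \<open>E \<subseteq> V \<times> V\<close>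
  show ?case
  proof (cases "card V \<le> k + 1")
    case True
    then show ?thesis using less.prems
      by (intro exI[of _ "[V]"]) (auto simp: bag_list_def)
  next
    case False
    define Sep where "Sep = (\<lambda>X. finite X \<and> card X \<le> a \<and>
      (\<exists>b\<in>V - X. \<exists>b'\<in>V - X. (b, b') \<notin> (Restr E (- X))\<^sup>*))"
    \<comment> \<open>V has at least k + 2 vertices, so it is not inseparable itself. For a
      separator A of least size, giving back any one vertex of A reconnects b and b'.\<close>
    have "\<exists>X. Sep X"
      using less.prems(4)[of V] False unfolding inseparable_def Sep_def by force
    then obtain A where A: "Sep A" and min: "\<And>X. Sep X \<Longrightarrow> card A \<le> card X"
      using ex_has_least_nat[of Sep _ card] by blast
    from A obtain b b' where finA: "finite A" and cA: "card A \<le> a"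
      and b: "b \<in> V - A" "b' \<in> V - A" and nb: "(b, b') \<notin> (Restr E (- A))\<^sup>*"
      unfolding Sep_def by blast
    have nb': "(b', b) \<notin> (Restr E (- A))\<^sup>*"
      using nb sym_Restr_rtrancl[OF sym] by (meson symD)
    have conn: "(b, b') \<in> (Restr E (- (A - {x})))\<^sup>*" if "x \<in> A" for x
    proof (rule ccontr)
      assume "\<not> ?thesis"
      moreover have less: "card (A - {x}) < card A" using finA that by (rule card_Diff1_less)
      ultimately have "Sep (A - {x})" unfolding Sep_def using finA cA b by auto
      then show False using min less by fastforce
    qed
    have conn': "(b', b) \<in> (Restr E (- (A - {x})))\<^sup>*" if "x \<in> A" for x
      using conn[OF that] sym_Restr_rtrancl[OF sym] by (meson symD)
    define D where "D = comp_avoiding E A b"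
    define D' where "D' = comp_avoiding E A b'"
    have nbD: "\<exists>d\<in>D. (x, d) \<in> E" if "x \<in> A" for x
      unfolding D_def using minimal_separator_neighbour[OF sym nb _ _ conn[OF that] that] b by auto
    have nbD': "\<exists>d\<in>D'. (x, d) \<in> E" if "x \<in> A" for x
      unfolding D'_def using minimal_separator_neighbour[OF sym nb' _ _ conn'[OF that] that] b by auto
    have DA: "D \<inter> A = {}" "D' \<inter> A = {}"
      unfolding D_def D'_def using comp_avoiding_disjoint b by (metis DiffD2)+
    have AV: "A \<subseteq> V" using nbD EV by blast
    have DV: "D \<subseteq> V"
    proof
      fix y assume "y \<in> D"
      then have "(b, y) \<in> (Restr E (- A))\<^sup>*" by (simp add: D_def)
      then show "y \<in> V" using b EV by (cases rule: rtranclE) auto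
    qed
    have bD: "b \<in> D" "b' \<notin> D" using nb by (auto simp: D_def)
    have step: "w \<in> D" if "u \<in> D" "(u, w) \<in> E" "w \<notin> A" for u w
      using comp_avoiding_step[of u E A b w] that b unfolding D_def by auto
    have DD': "D' \<inter> D = {}"
    proof -
      have False if "(b, y) \<in> (Restr E (- A))\<^sup>*" "(b', y) \<in> (Restr E (- A))\<^sup>*" for y
      proof -
        have "(y, b') \<in> (Restr E (- A))\<^sup>*"
          using that(2) sym_Restr_rtrancl[OF sym] by (meson symD)
        then show False using nb rtrancl_trans[OF that(1)] by blast
      qed
      then show ?thesis by (auto simp: D_def D'_def)
    qed
    \<comment> \<open>The two sides are the component D of b together with A, and everything outside
      D. Both are smaller than V, since P misses b' and Q misses b.\<close>
    define P where "P = D \<union> A"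
    define Q where "Q = V - D"
    have PQ: "P \<union> Q = V" "P \<inter> Q = A" "A \<subseteq> P" "A \<subseteq> Q"
      using DV AV DA by (auto simp: P_def Q_def)
    have cP: "card P < card V"
      using fin bD b DV AV by (intro psubset_card_mono) (auto simp: P_def)
    have cQ: "card Q < card V"
      using fin bD b DV AV by (intro psubset_card_mono) (auto simp: Q_def)
    have cover: "E \<subseteq> Restr E P \<union> Restr E Q"
    proof
      fix e assume e: "e \<in> E"
      obtain u w where uw: "e = (u, w)" by (cases e)
      show "e \<in> Restr E P \<union> Restr E Q"
        using step[of u w] step[of w u] e uw sym EV by (auto simp: P_def Q_def dest: symD)
    qed
    \<comment> \<open>The torso of each side borrows its connecting set from the other: the
      component D' of b' serves P, and D serves Q.\<close>
    have insP: "\<not> inseparable a (Restr E P \<union> A \<times> A) B" if "B \<subseteq> P" "k + 2 \<le> card B" for B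
    proof
      assume ins: "inseparable a (Restr E P \<union> A \<times> A) B"
      have "inseparable a E B"
        by (rule inseparable_torso[OF sym finA PQ(3) cA \<open>a \<le> 2\<close> that(1) _ _ _ nbD' ins])
          (use that \<open>a \<le> k\<close> DD' DA comp_avoiding_connected[OF sym] in \<open>auto simp: P_def D'_def\<close>)
      moreover have "B \<subseteq> V" using that PQ by blast
      ultimately show False using less.prems(4) that by blast
    qed
    have insQ: "\<not> inseparable a (Restr E Q \<union> A \<times> A) B" if "B \<subseteq> Q" "k + 2 \<le> card B" for B
    proof
      assume ins: "inseparable a (Restr E Q \<union> A \<times> A) B"
      have "inseparable a E B"
        by (rule inseparable_torso[OF sym finA PQ(4) cA \<open>a \<le> 2\<close> that(1) _ _ _ nbD ins])
          (use that \<open>a \<le> k\<close> comp_avoiding_connected[OF sym] in \<open>auto simp: Q_def D_def\<close>)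
      moreover have "B \<subseteq> V" using that PQ by blast
      ultimately show False using less.prems(4) that by blast
    qed
    \<comment> \<open>The side \<open>V\<^sub>1\<close> contains R and comes first, so that R stays
      in the head bag; the recursion on \<open>V\<^sub>2\<close> asks for A in its head instead. The
      sides are left arbitrary because R may lie in P or in Q.\<close>
    have combine: ?thesis
      if V12: "card V\<^sub>1 < card V" "card V\<^sub>2 < card V" "V\<^sub>1 \<union> V\<^sub>2 = V" "V\<^sub>1 \<inter> V\<^sub>2 = A" "R \<subseteq> V\<^sub>1"
        and cov: "E \<subseteq> Restr E V\<^sub>1 \<union> Restr E V\<^sub>2"
        and i1: "\<And>B. B \<subseteq> V\<^sub>1 \<Longrightarrow> k + 2 \<le> card B \<Longrightarrow> \<not> inseparable a (Restr E V\<^sub>1 \<union> A \<times> A) B"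
        and i2: "\<And>B. B \<subseteq> V\<^sub>2 \<Longrightarrow> k + 2 \<le> card B \<Longrightarrow> \<not> inseparable a (Restr E V\<^sub>2 \<union> A \<times> A) B"
      for V\<^sub>1 V\<^sub>2
    proof -
      have A12: "A \<subseteq> V\<^sub>1" "A \<subseteq> V\<^sub>2" using V12 by auto
      have fin12: "finite V\<^sub>1" "finite V\<^sub>2" using fin V12(3) by auto
      have symT: "sym (Restr E W \<union> A \<times> A)" for W using sym by (auto simp: sym_def)
      have "\<forall>x\<in>R. \<forall>y\<in>R. x \<noteq> y \<longrightarrow> (x, y) \<in> Restr E V\<^sub>1 \<union> A \<times> A"
        using less.prems(6) V12(5) by blast
      then obtain Bs where Bs: "bag_list k a Bs" "\<Union>(set Bs) = V\<^sub>1" "R \<subseteq> hd Bs"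
          "\<forall>(u, w)\<in>Restr E V\<^sub>1 \<union> A \<times> A. \<exists>B\<in>set Bs. u \<in> B \<and> w \<in> B"
        using less.hyps[OF V12(1) fin12(1) symT _ i1 V12(5)] A12(1) by blast
      obtain Cs where Cs: "bag_list k a Cs" "\<Union>(set Cs) = V\<^sub>2" "A \<subseteq> hd Cs"
          "\<forall>(u, w)\<in>Restr E V\<^sub>2 \<union> A \<times> A. \<exists>B\<in>set Cs. u \<in> B \<and> w \<in> B"
        using less.hyps[OF V12(2) fin12(2) symT _ i2 A12(2)] A12(2) by blast
      have "Bs \<noteq> []" using Bs(1) by (simp add: bag_list_def)
      moreover have "\<forall>(u, w)\<in>A \<times> A. \<exists>B\<in>set Bs. u \<in> B \<and> w \<in> B" using Bs(4) by blast
      ultimately obtain B where B: "B \<in> set Bs" "A \<subseteq> B"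
        using clique_covered[OF finA] cA \<open>a \<le> 2\<close> by (meson le_trans)
      have "bag_list k a (Bs @ Cs)"
        by (rule bag_list_append[OF Bs(1) Cs(1) _ finA cA Cs(3) B]) (use Bs(2) Cs(2) V12 in auto)
      moreover have "\<exists>B\<in>set (Bs @ Cs). u \<in> B \<and> w \<in> B" if uw: "(u, w) \<in> E" for u w
      proof -
        consider "(u, w) \<in> Restr E V\<^sub>1" | "(u, w) \<in> Restr E V\<^sub>2" using cov uw by blast
        then show ?thesis
        proof cases
          case 1
          then have "\<exists>B\<in>set Bs. u \<in> B \<and> w \<in> B" using bspec[OF Bs(4), of "(u, w)"] by simp
          then show ?thesis by auto
        next
          case 2
          then have "\<exists>B\<in>set Cs. u \<in> B \<and> w \<in> B" using bspec[OF Cs(4), of "(u, w)"] by simp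
          then show ?thesis by auto
        qed
      qed
      moreover have "\<Union>(set (Bs @ Cs)) = V" using Bs(2) Cs(2) V12(3) by auto
      moreover have "R \<subseteq> hd (Bs @ Cs)" using Bs(3) \<open>Bs \<noteq> []\<close> by simp
      ultimately show ?thesis by blast
    qed
    \<comment> \<open>No edge joins D to a vertex outside P, so the clique R cannot have vertices in
      both.\<close>
    have "R \<subseteq> P \<or> R \<subseteq> Q"
    proof (rule ccontr)
      assume "\<not> ?thesis"
      then obtain x y where "x \<in> R" "x \<notin> P" "y \<in> R" "y \<in> D"
        using \<open>R \<subseteq> V\<close> by (auto simp: Q_def)
      moreover from this have "(y, x) \<in> E" using less.prems(6) by (auto simp: P_def)
      ultimately show False using step[of y x] by (auto simp: P_def)
    qed
    then show ?thesis
    proof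
      assume "R \<subseteq> P"
      then show ?thesis using combine[of P Q] cP cQ PQ cover insP insQ by blast
    next
      assume "R \<subseteq> Q"
      moreover have "Q \<union> P = V" "Q \<inter> P = A" using PQ by auto
      ultimately show ?thesis using combine[of Q P] cP cQ cover insP insQ by blast
    qed
  qed
qed

section \<open>Undirected trees\<close>

lemma pair_graph_iff:
  "pair_graph G \<longleftrightarrow> finite (pverts G) \<and> parcs G \<subseteq> pverts G \<times> pverts G \<and> sym (parcs G) \<and>
     irrefl (parcs G)"
proof
  assume "pair_graph G"
  then interpret pair_graph G .
  show "finite (pverts G) \<and> parcs G \<subseteq> pverts G \<times> pverts G \<and> sym (parcs G) \<and> irrefl (parcs G)"
    using pair_finite_verts arcs_symmetric no_loops' in_arcsD1 in_arcsD2
    by (auto simp: irrefl_def intro: symI)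
next
  assume "finite (pverts G) \<and> parcs G \<subseteq> pverts G \<times> pverts G \<and> sym (parcs G) \<and> irrefl (parcs G)"
  then show "pair_graph G"
    by unfold_locales (auto simp: irrefl_def symmetric_def intro: finite_subset)
qed

lemma rtrancl_on_eq_Restr:
  assumes "u \<in> S"
  shows "(u, v) \<in> rtrancl_on S r \<longleftrightarrow> (u, v) \<in> (Restr r S)\<^sup>*"
proof
  assume "(u, v) \<in> rtrancl_on S r"
  then show "(u, v) \<in> (Restr r S)\<^sup>*"
  proof (induction rule: rtrancl_on_induct)
    case (step y z)
    then have "(y, z) \<in> Restr r S" by auto
    with step show ?case by (meson rtrancl.rtrancl_into_rtrancl)
  qed auto
next
  assume "(u, v) \<in> (Restr r S)\<^sup>*"
  then show "(u, v) \<in> rtrancl_on S r"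
    by (induction rule: rtrancl_induct) (use assms in \<open>auto intro: rtrancl_on_into_rtrancl_on\<close>)
qed

text \<open>\<open>connected\<close> is strong connectivity of the symmetric closure, and a
  symmetric arc set is its own closure.\<close>

lemma connected_induce_iff:
  assumes "sym (parcs T)"
  shows "connected (with_proj T \<restriction> S) \<longleftrightarrow> S \<noteq> {} \<and> S \<times> S \<subseteq> (Restr (parcs T) S)\<^sup>*"
proof -
  have "parcs (mk_symmetric (with_proj T \<restriction> S)) = Restr (parcs T) S"
    using assms by (force simp: parcs_mk_symmetric dest: symD)
  moreover have "Restr (Restr (parcs T) S) S = Restr (parcs T) S" by auto
  ultimately show ?thesis
    unfolding connected_def strongly_connected_def reachable_def
    by (auto simp: rtrancl_on_eq_Restr)
qed

lemma connected_with_proj_iff: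
  assumes "pair_graph T"
  shows "connected (with_proj T) \<longleftrightarrow> pverts T \<noteq> {} \<and> pverts T \<times> pverts T \<subseteq> (parcs T)\<^sup>*"
proof -
  have sym: "sym (parcs T)" and sub: "parcs T \<subseteq> pverts T \<times> pverts T"
    using assms by (auto simp: pair_graph_iff)
  have "with_proj T \<restriction> pverts T = with_proj T"
    using sub by (auto simp: induce_subgraph_def with_proj_def)
  moreover have "Restr (parcs T) (pverts T) = parcs T" using sub by auto
  ultimately show ?thesis using connected_induce_iff[OF sym, of "pverts T"] by simp
qed

lemma rtrancl_simple_path:
  assumes "(u, v) \<in> R\<^sup>*"
  obtains p where "pcas u p v" "set p \<subseteq> R" "distinct (pawalk_verts u p)"
proof -
  \<comment> \<open>The relation becomes a digraph on the whole type, where reachability is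
    witnessed by a path without repeated vertices.\<close>
  let ?G = "\<lparr>pverts = UNIV, parcs = R\<rparr>"
  interpret pair_wf_digraph ?G by unfold_locales auto
  have "u \<rightarrow>\<^sup>*\<^bsub>with_proj ?G\<^esub> v"
    using assms by (simp add: reachable_def rtrancl_on_eq_Restr)
  then obtain p where "apath u p v" using reachable_apath by blast
  then show thesis by (intro that[of p]) (auto simp: apath_def awalk_def)
qed

lemma set_pawalk_verts: "set (pawalk_verts u p) \<subseteq> insert u (fst ` set p \<union> snd ` set p)"
  by (induction p arbitrary: u) auto

lemma pcas_snoc: "pcas u (p @ [e]) v \<longleftrightarrow> pcas u p (fst e) \<and> snd e = v"
  by (induction p arbitrary: u) auto

lemma pawalk_verts_snoc: "pcas u p (fst e) \<Longrightarrow> pawalk_verts u (p @ [e]) = pawalk_verts u p @ [snd e]"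
  by (induction p arbitrary: u) auto

lemma tl_pawalk_verts: "pcas u p v \<Longrightarrow> tl (pawalk_verts u p) = map snd p"
proof (induction p arbitrary: u)
  case (Cons e p)
  have "pawalk_verts (snd e) p = snd e # tl (pawalk_verts (snd e) p)"
    by (cases p) (use Cons.prems in auto)
  then show ?case using Cons by auto
qed simp

text \<open>Otherwise a simple path from s to s' inside S, closed up through t, would be a cycle of
  length at least 3.\<close>

lemma undirected_tree_unique_neighbour:
  assumes T: "undirected_tree T" and S: "S \<times> S \<subseteq> (Restr (parcs T) S)\<^sup>*" "t \<notin> S"
    and s: "s \<in> S" "s' \<in> S" "(s, t) \<in> parcs T" "(s', t) \<in> parcs T"
  shows "s = s'"
proof (rule ccontr)
  assume ne: "s \<noteq> s'"
  have G: "pair_graph T" using T by (simp add: undirected_tree_def)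
  then interpret pair_graph T .
  obtain p where p: "pcas s p s'" "set p \<subseteq> Restr (parcs T) S" "distinct (pawalk_verts s p)"
    using S(1) s rtrancl_simple_path[of s s' "Restr (parcs T) S"] by blast
  have p0: "p \<noteq> []" using p(1) ne by auto
  have "set (pawalk_verts s p) \<subseteq> S"
    using set_pawalk_verts[of s p] p(2) s(1) by fastforce
  then have "distinct (pawalk_verts s (p @ [(s', t)]))"
    using p(1,3) S(2) by (auto simp: pawalk_verts_snoc)
  moreover have "pcas s (p @ [(s', t)]) t"
    using p(1) by (simp only: pcas_snoc fst_conv snd_conv simp_thms)
  ultimately have "cycle ((t, s) # p @ [(s', t)])"
    unfolding cycle_def awalk_def using p(2) s(4) arcs_symmetric[OF s(3)] in_arcsD2[OF s(3)]
    by (intro exI[of _ t]) (auto simp del: cas_append_iff)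
  moreover have "3 \<le> length ((t, s) # p @ [(s', t)])" using p0 by (cases p) auto
  ultimately show False using T unfolding undirected_tree_def by blast
qed

section \<open>Extending local choices along a tree\<close>

lemma rtrancl_leaves:
  assumes "(x, y) \<in> E\<^sup>*" "x \<in> S" "y \<notin> S"
  shows "\<exists>s t. (s, t) \<in> E \<and> s \<in> S \<and> t \<notin> S"
  using assms by (induction rule: rtrancl_induct) auto

text \<open>Choices are extended from a connected node set S to one further node t. As t has a
  unique neighbour in S, a single pair of opposite arcs constrains the choice at t, and
  \<open>symR\<close> settles the reverse one. A maximal such S is the whole tree.\<close>

lemma undirected_tree_propagate:
  assumes T: "undirected_tree T" and t0: "t0 \<in> pverts T" "good t0 f0"
    and step: "\<And>s t f. (s, t) \<in> parcs T \<Longrightarrow> good s f \<Longrightarrow> \<exists>g. good t g \<and> R s t f g"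
    and symR: "\<And>s t f g. R s t f g \<Longrightarrow> R t s g f"
  shows "\<exists>f. (\<forall>t\<in>pverts T. good t (f t)) \<and> (\<forall>(s, t)\<in>parcs T. R s t (f s) (f t))"
proof -
  let ?E = "parcs T"
  have G: "pair_graph T" using T by (simp add: undirected_tree_def)
  then have fin: "finite (pverts T)" and sub: "?E \<subseteq> pverts T \<times> pverts T" and sym: "sym ?E"
    and irr: "irrefl ?E"
    by (auto simp: pair_graph_iff)
  \<comment> \<open>Connectedness of S belongs to the invariant because uniqueness of the neighbour
    rests on it.\<close>
  define \<P> where "\<P> = (\<lambda>S. S \<subseteq> pverts T \<and> t0 \<in> S \<and> S \<times> S \<subseteq> (Restr ?E S)\<^sup>* \<and>
    (\<exists>f. (\<forall>t\<in>S. good t (f t)) \<and> (\<forall>(s, t)\<in>Restr ?E S. R s t (f s) (f t))))"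
  have "\<P> {t0}" unfolding \<P>_def using t0 irr
    by (auto simp: irrefl_def intro!: exI[of _ "\<lambda>_. f0"])
  moreover have "finite {S. \<P> S}"
    by (rule finite_subset[of _ "Pow (pverts T)"]) (use fin in \<open>auto simp: \<P>_def\<close>)
  ultimately obtain S where S: "\<P> S" and max: "\<And>S'. \<P> S' \<Longrightarrow> S \<subseteq> S' \<Longrightarrow> S' = S"
    using finite_has_maximal[of "{S. \<P> S}"] by (metis empty_iff mem_Collect_eq)
  from S obtain f where SV: "S \<subseteq> pverts T" and t0S: "t0 \<in> S" and conn: "S \<times> S \<subseteq> (Restr ?E S)\<^sup>*"
    and f: "\<forall>t\<in>S. good t (f t)" "\<forall>(s, t)\<in>Restr ?E S. R s t (f s) (f t)"
    unfolding \<P>_def by blast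
  have "S = pverts T"
  proof (rule ccontr)
    assume "S \<noteq> pverts T"
    then obtain y where y: "y \<in> pverts T" "y \<notin> S" using SV by auto
    then have "(t0, y) \<in> ?E\<^sup>*"
      using T t0 connected_with_proj_iff[OF G] unfolding undirected_tree_def by auto
    then obtain s t where st: "(s, t) \<in> ?E" "s \<in> S" "t \<notin> S"
      using rtrancl_leaves[OF _ t0S y(2)] by blast
    obtain g where g: "good t g" "R s t (f s) g" using step[OF st(1)] f st by blast
    have uniq: "s' = s" if "s' \<in> S" "(s', t) \<in> ?E" for s'
      using undirected_tree_unique_neighbour[OF T conn st(3)] that st by blast
    let ?S = "insert t S" and ?f = "f(t := g)"
    have "Restr ?E S \<subseteq> Restr ?E ?S" by auto
    then have mono: "(Restr ?E S)\<^sup>* \<subseteq> (Restr ?E ?S)\<^sup>*" by (rule rtrancl_mono)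
    have sts: "(s, t) \<in> Restr ?E ?S" "(t, s) \<in> Restr ?E ?S" using st sym by (auto dest: symD)
    have ts: "(x, s) \<in> (Restr ?E ?S)\<^sup>*" "(s, x) \<in> (Restr ?E ?S)\<^sup>*" if "x \<in> ?S" for x
      using that sts conn mono st(2) by auto
    have "?S \<times> ?S \<subseteq> (Restr ?E ?S)\<^sup>*" using ts by (blast intro: rtrancl_trans)
    moreover have "\<forall>x\<in>?S. good x (?f x)" using f g st(3) by auto
    moreover have "R x y (?f x) (?f y)" if xy: "(x, y) \<in> Restr ?E ?S" for x y
    proof -
      have "x \<noteq> y" using xy irr by (auto simp: irrefl_def)
      then consider "x \<in> S" "y \<in> S" | "x \<in> S" "y = t" | "x = t" "y \<in> S" using xy by auto
      then show ?thesis
      proof cases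
        case 1
        then show ?thesis using f(2) xy st(3) by auto
      next
        case 2
        then show ?thesis using uniq[of x] xy g st by auto
      next
        case 3
        then have "y = s" using uniq[of y] xy sym by (auto dest: symD)
        then show ?thesis using 3 g symR st by auto
      qed
    qed
    ultimately have "\<P> ?S" unfolding \<P>_def using SV t0S st sub by blast
    then show False using max[of ?S] st by auto
  qed
  then show ?thesis using f sub by (intro exI[of _ f]) blast
qed

section \<open>From bag lists to tree decompositions\<close>

lemma snd_nth_pcas:
  assumes "pcas u p v" "i < length p"
  shows "snd (p ! i) = (if Suc i < length p then fst (p ! Suc i) else v)"
  using assms
proof (induction p arbitrary: u i)
  case (Cons e p)
  show ?case
  proof (cases i)
    case 0
    then show ?thesis using Cons.prems by (cases p) auto
  next
    case (Suc j)
    then show ?thesis using Cons.IH[of "snd e" j] Cons.prems by auto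
  qed
qed simp

text \<open>At the largest vertex of a cycle both neighbours would have to be its unique smaller one.\<close>

lemma cycle_length_less_3:
  fixes T :: "'t :: linorder pair_pre_digraph"
  assumes G: "pair_graph T"
    and uniq: "\<And>x y z. (x, z) \<in> parcs T \<Longrightarrow> (y, z) \<in> parcs T \<Longrightarrow> x < z \<Longrightarrow> y < z \<Longrightarrow> x = y"
    and cyc: "pre_digraph.cycle (with_proj T) p"
  shows "length p < 3"
proof (rule ccontr)
  assume len: "\<not> length p < 3"
  interpret pair_graph T by (rule G)
  from cyc obtain u where u: "pcas u p u" "set p \<subseteq> parcs T" "distinct (tl (pawalk_verts u p))"
    unfolding cycle_def awalk_def by auto
  \<comment> \<open>Dropping the start vertex, which a closed walk repeats at its end, leaves the
    heads of the arcs.\<close>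
  have dist: "distinct (map snd p)" using u tl_pawalk_verts by metis
  define n where "n = length p"
  have n: "3 \<le> n" using len by (simp add: n_def)
  have modn: "i mod n < length p" for i using n by (simp add: n_def mod_less_divisor del: length_greater_0_conv)
  \<comment> \<open>Indexing modulo n makes the first arc follow the last one.\<close>
  define q where "q = (\<lambda>i. p ! (i mod n))"
  have qp: "q i \<in> parcs T" for i
    unfolding q_def by (intro subsetD[OF u(2)] nth_mem modn)
  have u0: "u = fst (p ! 0)" using u(1) n by (cases p) (auto simp: n_def)
  have link: "snd (q i) = fst (q (Suc i))" for i
  proof -
    show ?thesis
      using snd_nth_pcas[OF u(1) modn, of i] u0 modn[of i] by (auto simp: q_def mod_Suc n_def)
  qed
  have inj: "i mod n = j mod n" if "snd (q i) = snd (q j)" for i j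
    using that dist modn[of i] modn[of j] by (auto simp: q_def distinct_conv_nth)
  define M where "M = Max (set (map snd p))"
  have p0: "p \<noteq> []" using n by (auto simp: n_def)
  then have "M \<in> set (map snd p)" unfolding M_def by (intro Max_in) auto
  then obtain i where "i < n" "snd (p ! i) = M" by (auto simp: in_set_conv_nth n_def)
  then have i: "snd (q i) = M" by (simp add: q_def)
  have le: "snd (q j) \<le> M" for j
    unfolding M_def using nth_mem[OF modn, of j] by (auto simp: q_def)
  \<comment> \<open>h is the cyclic predecessor of i, shifted by n to stay natural when i =
    0.\<close>
  obtain h where h: "i + n - 1 = h" "Suc h = i + n" using n by simp
  have qper: "q (i + n) = q i" by (simp add: q_def)
  have "fst (q i) = snd (q h)" using link[of h] h qper by simp
  then have "fst (q i) < M" using le[of h] no_loops'[of "fst (q i)" "snd (q i)"] qp[of i] i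
    by (metis order_le_less prod.collapse)
  moreover have "snd (q (Suc i)) < M"
    using le[of "Suc i"] no_loops'[of "fst (q (Suc i))" "snd (q (Suc i))"] qp[of "Suc i"] i link[of i]
    by (metis order_le_less prod.collapse)
  moreover have "(fst (q i), M) \<in> parcs T" using qp[of i] i by (metis prod.collapse)
  moreover have "(snd (q (Suc i)), M) \<in> parcs T"
    using qp[of "Suc i"] i link[of i] arcs_symmetric by (metis prod.collapse)
  ultimately have "fst (q i) = snd (q (Suc i))" using uniq by blast
  \<comment> \<open>The vertices before and after M are the heads of the arcs at i - 1 and i + 1.
    Heads are distinct, so if these two coincide then n divides 2.\<close>
  then have "snd (q h) = snd (q (Suc i))" using link[of h] h qper by simp
  then have "h mod n = Suc i mod n" by (rule inj)
  then have "(h + 1) mod n = (Suc i + 1) mod n" by (rule mod_add_cong) simp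
  then have "i mod n = (i + 2) mod n" using h by simp
  then have "n dvd 2" by (metis add_diff_cancel_left' le_add1 mod_eq_dvd_iff_nat)
  then show False using n by (auto dest: dvd_imp_le)
qed

text \<open>Node i > 0 is joined to an earlier node \<open>par i\<close> whose bag contains
  everything that bag i shares with the bags before it. The parent is the only smaller neighbour of
  a node, which rules out long cycles.\<close>

lemma tree_decomposition_of_bag_list:
  fixes G :: "'a pair_pre_digraph"
  assumes G: "pair_graph G" and Bs: "bag_list k a Bs" and U: "\<Union>(set Bs) = pverts G"
    and cover: "\<forall>(u, w)\<in>parcs G. \<exists>B\<in>set Bs. u \<in> B \<and> w \<in> B"
  shows "\<exists>(T :: ngraph) \<beta>. tree_decomposition G T \<beta> \<and> td_width T \<beta> \<le> int k \<and> td_adhesion T \<beta> \<le> a"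
proof -
  define n where "n = length Bs"
  have n: "0 < n" using Bs by (simp add: bag_list_def n_def)
  have "\<forall>i. \<exists>j. 0 < i \<and> i < n \<longrightarrow>
      j < i \<and> Bs ! i \<inter> \<Union>(set (take i Bs)) \<subseteq> Bs ! j \<and> card (Bs ! i \<inter> Bs ! j) \<le> a"
    using Bs unfolding bag_list_def n_def by blast
  then obtain par where par: "\<And>i. 0 < i \<Longrightarrow> i < n \<Longrightarrow> par i < i"
      "\<And>i. 0 < i \<Longrightarrow> i < n \<Longrightarrow> Bs ! i \<inter> \<Union>(set (take i Bs)) \<subseteq> Bs ! par i"
      "\<And>i. 0 < i \<Longrightarrow> i < n \<Longrightarrow> card (Bs ! i \<inter> Bs ! par i) \<le> a"
    by metis
  define E where "E = {(i, j). (0 < i \<and> i < n \<and> j = par i) \<or> (0 < j \<and> j < n \<and> i = par j)}"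
  define T where "T = \<lparr>pverts = {..<n}, parcs = E\<rparr>"
  define \<beta> where "\<beta> = (\<lambda>i. Bs ! i)"
  have symE: "sym E" by (auto simp: E_def sym_def)
  have TG: "pair_graph T"
    unfolding pair_graph_iff
  proof (intro conjI)
    have "par i < n" if "0 < i" "i < n" for i using par(1)[OF that] that by simp
    then show "parcs T \<subseteq> pverts T \<times> pverts T" by (auto simp: T_def E_def)
    have "par i \<noteq> i" if "0 < i" "i < n" for i using par(1)[OF that] by simp
    then show "irrefl (parcs T)" by (auto simp: T_def E_def irrefl_def dest: sym)
  qed (use symE in \<open>auto simp: T_def\<close>)
  \<comment> \<open>A node set closed under parents except at m is connected: climbing decreases the
    index and can stop only at m. This serves twice, for the whole tree and for the nodes whose bags
    contain a given vertex.\<close>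
  have conn: "S \<times> S \<subseteq> (Restr E S)\<^sup>*"
    if S: "S \<subseteq> {..<n}" "\<And>t. t \<in> S \<Longrightarrow> t \<noteq> m \<Longrightarrow> 0 < t \<and> par t \<in> S" for S m
  proof -
    have root: "(t, m) \<in> (Restr E S)\<^sup>*" if "t \<in> S" for t
      using that
    proof (induction t rule: less_induct)
      case (less t)
      show ?case
      proof (cases "t = m")
        case False
        then have t: "0 < t" "par t \<in> S" "t < n" using S less.prems by auto
        then have "(t, par t) \<in> Restr E S" using less.prems by (auto simp: E_def)
        then show ?thesis
          using less.IH[of "par t"] t par(1) by (meson converse_rtrancl_into_rtrancl)
      qed auto
    qed
    have "sym ((Restr E S)\<^sup>*)" by (rule sym_Restr_rtrancl[OF symE])
    then have "(s, t) \<in> (Restr E S)\<^sup>*" if "s \<in> S" "t \<in> S" for s t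
      using rtrancl_trans[OF root[OF that(1)] symD[OF _ root[OF that(2)]]] by blast
    then show ?thesis by blast
  qed
  have "Restr E {..<n} = E" using TG by (auto simp: pair_graph_iff T_def)
  moreover have "0 < t \<and> par t \<in> {..<n}" if "t \<in> {..<n}" "t \<noteq> 0" for t
    using par(1)[of t] that by auto
  ultimately have "{..<n} \<times> {..<n} \<subseteq> E\<^sup>*" using conn[of "{..<n}" 0] by simp
  then have "connected (with_proj T)"
    using n unfolding connected_with_proj_iff[OF TG] by (auto simp: T_def)
  moreover have "length p < 3" if "pre_digraph.cycle (with_proj T) p" for p
  proof (rule cycle_length_less_3[OF TG _ that])
    fix x y z assume "(x, z) \<in> parcs T" "(y, z) \<in> parcs T" "x < z" "y < z"
    moreover have "w = par z" if "(w, z) \<in> parcs T" "w < z" for w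
      using that par(1)[of w] by (auto simp: T_def E_def)
    ultimately show "x = y" by blast
  qed
  ultimately have tree: "undirected_tree T"
    unfolding undirected_tree_def using TG by fastforce
  have "connected (with_proj T \<restriction> {t \<in> pverts T. v \<in> \<beta> t})" if "v \<in> pverts G" for v
  proof -
    let ?S = "{t \<in> pverts T. v \<in> \<beta> t}"
    have ne: "?S \<noteq> {}"
      using that unfolding U[symmetric] by (auto simp: T_def \<beta>_def n_def in_set_conv_nth)
    \<comment> \<open>The least node whose bag contains v acts as root: any later bag with v shares
      v with bag m, so its parent has v too.\<close>
    define m where "m = (LEAST t. t \<in> ?S)"
    have mS: "m \<in> ?S" unfolding m_def by (rule LeastI_ex) (use ne in blast)
    have "0 < t \<and> par t \<in> ?S" if t: "t \<in> ?S" "t \<noteq> m" for t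
    proof -
      have "m \<le> t" unfolding m_def using t(1) by (rule Least_le)
      then have mt: "m < t" using t(2) by simp
      have tn: "t < n" using t by (simp add: T_def)
      have "Bs ! m \<in> set (take t Bs)" using nth_mem[of m "take t Bs"] mt tn by (simp add: n_def)
      then have "v \<in> Bs ! par t" using par(2)[of t] mt tn t mS by (auto simp: \<beta>_def)
      moreover have "par t < n" using par(1)[of t] mt tn by simp
      ultimately show ?thesis using mt by (auto simp: T_def \<beta>_def)
    qed
    then have "?S \<times> ?S \<subseteq> (Restr E ?S)\<^sup>*" by (intro conn[of _ m]) (auto simp: T_def)
    then show ?thesis using ne connected_induce_iff[of T ?S] symE by (simp add: T_def)
  qed
  moreover have "(\<Union>t\<in>pverts T. \<beta> t) = pverts G"
    unfolding U[symmetric] set_conv_nth by (auto simp: T_def \<beta>_def n_def)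
  moreover have "\<forall>(u, v)\<in>parcs G. \<exists>t\<in>pverts T. u \<in> \<beta> t \<and> v \<in> \<beta> t"
  proof (intro ballI, clarify)
    fix u v assume "(u, v) \<in> parcs G"
    then obtain B where "B \<in> set Bs" "u \<in> B" "v \<in> B" using cover by blast
    then show "\<exists>t\<in>pverts T. u \<in> \<beta> t \<and> v \<in> \<beta> t"
      by (auto simp: T_def \<beta>_def n_def in_set_conv_nth)
  qed
  ultimately have "tree_decomposition G T \<beta>" using tree unfolding tree_decomposition_def by blast
  moreover have "td_width T \<beta> \<le> int k"
  proof -
    have "card (\<beta> t) \<le> k + 1" if "t < n" for t
      using Bs that by (auto simp: bag_list_def \<beta>_def n_def)
    then have "Max ((\<lambda>t. int (card (\<beta> t))) ` pverts T) \<le> int k + 1"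
      using n by (subst Max_le_iff) (force simp: T_def)+
    then show ?thesis by (simp add: td_width_def)
  qed
  moreover have "td_adhesion T \<beta> \<le> a"
  proof -
    have "finite E" using TG by (auto simp: pair_graph_iff T_def intro: finite_subset)
    then show ?thesis
      unfolding td_adhesion_def using par(3)
      by (subst Max_le_iff) (auto simp: T_def E_def \<beta>_def Int_commute)
  qed
  ultimately show ?thesis by blast
qed

text \<open>The order a = \<open>min k 2\<close> satisfies a <= k, so that k + 2 <= |B| yields the
  bound a + 2 <= |B| of the torso argument, while the adhesion obtained is still at most 2. The
  outermost call has no clique to keep in the head bag, so R is empty.\<close>

lemma inseparable_of_not_in_td_class:
  assumes G: "pair_graph G" "G \<notin> td_class k 2"
  obtains B where "B \<subseteq> pverts G" "k + 2 \<le> card B" "inseparable (min k 2) (parcs G) B"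
proof (rule ccontr)
  assume neg: "\<not> thesis"
  let ?a = "min k 2"
  have "\<exists>Bs. bag_list k ?a Bs \<and> \<Union>(set Bs) = pverts G \<and>
    (\<forall>(u, w)\<in>parcs G. \<exists>B\<in>set Bs. u \<in> B \<and> w \<in> B) \<and> {} \<subseteq> hd Bs"
    by (rule bag_list_exists) (use G(1) neg that in \<open>auto simp: pair_graph_iff\<close>)
  then obtain Bs where "bag_list k ?a Bs" "\<Union>(set Bs) = pverts G"
      "\<forall>(u, w)\<in>parcs G. \<exists>B\<in>set Bs. u \<in> B \<and> w \<in> B"
    by blast
  from tree_decomposition_of_bag_list[OF G(1) this] obtain T :: ngraph and \<beta> where
    "tree_decomposition G T \<beta>" "td_width T \<beta> \<le> int k" "td_adhesion T \<beta> \<le> ?a"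
    by blast
  moreover have "td_adhesion T \<beta> \<le> 2" using calculation(3) by simp
  ultimately have "G \<in> td_class k 2" unfolding td_class_def using G(1) by blast
  then show False using G(2) by simp
qed

section \<open>CFI graphs\<close>

lemma odd_card_sym_diff:
  assumes "finite A" "finite B"
  shows "odd (card (sym_diff A B)) \<longleftrightarrow> odd (card A) \<noteq> odd (card B)"
proof -
  have "card (sym_diff A B) = card (A - B) + card (B - A)"
    using assms by (intro card_Un_disjoint) auto
  moreover have "card A = card (A - B) + card (A \<inter> B)"
    using card_Diff_subset_Int[of A B] assms by (metis add.commute card_Int_Diff)
  moreover have "card B = card (B - A) + card (A \<inter> B)"
    using assms by (metis Int_commute add.commute card_Int_Diff)
  ultimately show ?thesis by auto
qed

lemma sym_diff_Image: "sym_diff D C `` {u} = sym_diff (D `` {u}) (C `` {u})"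
  by auto

text \<open>Edge sets with boundary \<open>s + t\<close> over the two-element field.\<close>

definition path_chain :: "'a rel \<Rightarrow> 'a \<Rightarrow> 'a \<Rightarrow> 'a rel \<Rightarrow> bool" where
  "path_chain E s t D \<longleftrightarrow> sym D \<and> D \<subseteq> E \<and> (\<forall>u. odd (card (D `` {u})) \<longleftrightarrow> (u = s) \<noteq> (u = t))"

text \<open>The boundary is additive over the two-element field, and the two copies of t
  cancel.\<close>

lemma path_chain_add:
  assumes "finite E" "path_chain E s t D" "path_chain E t r C"
  shows "path_chain E s r (sym_diff D C)"
proof -
  have "finite D" "finite C" using assms by (auto simp: path_chain_def intro: finite_subset)
  then have "finite (D `` {u})" "finite (C `` {u})" for u by (auto intro: finite_Image)
  moreover have "sym (sym_diff D C)" using assms by (auto simp: path_chain_def sym_def)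
  ultimately show ?thesis
    using assms(2,3) unfolding path_chain_def sym_diff_Image by (auto simp: odd_card_sym_diff)
qed

lemma path_chain_exists:
  assumes "(s, t) \<in> E\<^sup>*" "finite E" "sym E" "irrefl E"
  shows "\<exists>D. path_chain E s t D"
  using assms(1)
proof (induction rule: rtrancl_induct)
  case base
  show ?case by (rule exI[of _ "{}"]) (auto simp: path_chain_def sym_def)
next
  case (step y z)
  then have "y \<noteq> z" "(z, y) \<in> E" using assms by (auto simp: irrefl_def dest: symD)
  moreover have "{(y, z), (z, y)} `` {u} = (if u = y then {z} else if u = z then {y} else {})" for u
    by auto
  ultimately have "path_chain E y z {(y, z), (z, y)}"
    using step.hyps unfolding path_chain_def by (auto simp: sym_def)
  with step.IH path_chain_add[OF assms(2)] show ?case by blast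
qed

text \<open>The gadget vertices over \<open>u\<close> are sets of edges at \<open>u\<close>, given by their other endpoints.\<close>

definition cfi :: "'a pair_pre_digraph \<Rightarrow> 'a set \<Rightarrow> ('a \<times> 'a set) pair_pre_digraph" where
  "cfi F W =
     (let V = {(u, S). u \<in> pverts F \<and> S \<subseteq> parcs F `` {u} \<and> (odd (card S) \<longleftrightarrow> u \<in> W)}
      in \<lparr>pverts = V,
          parcs = {((u, S), (w, S')). (u, S) \<in> V \<and> (w, S') \<in> V \<and> (u, w) \<in> parcs F \<and>
                     (w \<in> S \<longleftrightarrow> u \<in> S')}\<rparr>)"

lemma pverts_cfi:
  "(u, S) \<in> pverts (cfi F W) \<longleftrightarrow>
     u \<in> pverts F \<and> S \<subseteq> parcs F `` {u} \<and> (odd (card S) \<longleftrightarrow> u \<in> W)"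
  by (auto simp: cfi_def Let_def)

lemma parcs_cfi:
  "((u, S), (w, S')) \<in> parcs (cfi F W) \<longleftrightarrow>
     (u, S) \<in> pverts (cfi F W) \<and> (w, S') \<in> pverts (cfi F W) \<and> (u, w) \<in> parcs F \<and>
     (w \<in> S \<longleftrightarrow> u \<in> S')"
  by (auto simp: cfi_def Let_def)

lemma pair_graph_cfi:
  assumes "pair_graph F"
  shows "pair_graph (cfi F W)"
proof -
  have F: "finite (pverts F)" "parcs F \<subseteq> pverts F \<times> pverts F" "sym (parcs F)" "irrefl (parcs F)"
    using assms by (auto simp: pair_graph_iff)
  have "pverts (cfi F W) \<subseteq> pverts F \<times> Pow (pverts F)"
  proof
    fix z assume "z \<in> pverts (cfi F W)"
    moreover obtain u S where "z = (u, S)" by (cases z)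
    ultimately show "z \<in> pverts F \<times> Pow (pverts F)" using F(2) by (auto simp: pverts_cfi)
  qed
  then have "finite (pverts (cfi F W))"
    using F(1) by (meson finite_Pow_iff finite_SigmaI finite_subset)
  moreover have "sym (parcs (cfi F W))"
    using F(3) by (auto simp: sym_def parcs_cfi)
  ultimately show ?thesis
    unfolding pair_graph_iff using F(4) by (auto simp: parcs_cfi irrefl_def)
qed

section \<open>Lifts as solutions of a linear system\<close>

definition lifts :: "'b pair_pre_digraph \<Rightarrow> 'a pair_pre_digraph \<Rightarrow> 'a set \<Rightarrow> ('b \<Rightarrow> 'a) \<Rightarrow>
    ('b \<Rightarrow> 'a \<times> 'a set) set" where
  "lifts X F W h = {f \<in> graph_homs X (cfi F W). \<forall>x\<in>pverts X. fst (f x) = h x}"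

text \<open>The unknowns are the bits \<open>u \<in> snd (f x)\<close> for neighbours u of h x. The
  parity condition at each vertex and the agreement along each arc are linear equations, and only
  the parities depend on W.\<close>

lemma lifts_iff:
  assumes "pair_graph X" "h \<in> graph_homs X F"
  shows "f \<in> lifts X F W h \<longleftrightarrow> f \<in> extensional (pverts X) \<and>
    (\<forall>x\<in>pverts X. fst (f x) = h x \<and> snd (f x) \<subseteq> parcs F `` {h x} \<and>
       (odd (card (snd (f x))) \<longleftrightarrow> h x \<in> W)) \<and>
    (\<forall>(x, y)\<in>parcs X. h y \<in> snd (f x) \<longleftrightarrow> h x \<in> snd (f y))" (is "_ \<longleftrightarrow> ?R")
proof -
  have X: "x \<in> pverts X" "y \<in> pverts X" if "(x, y) \<in> parcs X" for x y
    using assms(1) that by (auto simp: pair_graph_iff)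
  have h: "h x \<in> pverts F" if "x \<in> pverts X" for x
    using assms(2) that by (auto simp: graph_homs_def)
  have hE: "(h x, h y) \<in> parcs F" if "(x, y) \<in> parcs X" for x y
    using assms(2) that by (auto simp: graph_homs_def)
  have V: "f x \<in> pverts (cfi F W) \<longleftrightarrow> snd (f x) \<subseteq> parcs F `` {h x} \<and>
      (odd (card (snd (f x))) \<longleftrightarrow> h x \<in> W)" if "x \<in> pverts X" "fst (f x) = h x" for x
    using that(2) h[OF that(1)] pverts_cfi[of "fst (f x)" "snd (f x)" F W]
    unfolding prod.collapse by simp
  have E: "(f x, f y) \<in> parcs (cfi F W) \<longleftrightarrow> f x \<in> pverts (cfi F W) \<and> f y \<in> pverts (cfi F W) \<and>
      (h y \<in> snd (f x) \<longleftrightarrow> h x \<in> snd (f y))"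
    if "(x, y) \<in> parcs X" "fst (f x) = h x" "fst (f y) = h y" for x y
    using that(2,3) hE[OF that(1)] parcs_cfi[of "fst (f x)" "snd (f x)" "fst (f y)" "snd (f y)" F W]
    unfolding prod.collapse by simp
  show ?thesis
  proof
    assume "f \<in> lifts X F W h"
    then have f: "f \<in> pverts X \<rightarrow>\<^sub>E pverts (cfi F W)" "\<forall>(x, y)\<in>parcs X. (f x, f y) \<in> parcs (cfi F W)"
      "\<forall>x\<in>pverts X. fst (f x) = h x"
      by (auto simp: lifts_def graph_homs_def)
    then show ?R using V E X by (fastforce simp: PiE_iff)
  next
    assume R: ?R
    then have fV: "f x \<in> pverts (cfi F W)" if "x \<in> pverts X" for x using V that by blast
    have "(f x, f y) \<in> parcs (cfi F W)" if "(x, y) \<in> parcs X" for x y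
      using E[OF that] fV X[OF that] R that by blast
    then show "f \<in> lifts X F W h"
      using R fV unfolding lifts_def graph_homs_def by (auto simp: PiE_iff)
  qed
qed

lemma finite_graph_homs:
  "finite (pverts X) \<Longrightarrow> finite (pverts Y) \<Longrightarrow> finite (graph_homs X Y)"
  unfolding graph_homs_def by (rule finite_subset[of _ "pverts X \<rightarrow>\<^sub>E pverts Y"]) (auto intro: finite_PiE)

lemma finite_lifts:
  assumes "pair_graph X" "pair_graph F"
  shows "finite (lifts X F W h)"
proof -
  have "finite (graph_homs X (cfi F W))"
    using assms pair_graph_cfi[OF assms(2), of W] by (intro finite_graph_homs) (auto simp: pair_graph_iff)
  then show ?thesis by (simp add: lifts_def)
qed

text \<open>Projection to the first component sends each homomorphism into the CFI graph to a
  homomorphism into F; the lifts of h are the fibre over h.\<close>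

lemma hom_count_cfi:
  assumes X: "pair_graph X" and F: "pair_graph F"
  shows "hom_count X (cfi F W) = (\<Sum>h\<in>graph_homs X F. card (lifts X F W h))"
proof -
  have XV: "x \<in> pverts X" "y \<in> pverts X" if "(x, y) \<in> parcs X" for x y
    using X that by (auto simp: pair_graph_iff)
  have "graph_homs X (cfi F W) = (\<Union>h\<in>graph_homs X F. lifts X F W h)"
  proof (intro subset_antisym subsetI)
    fix f assume f: "f \<in> graph_homs X (cfi F W)"
    let ?h = "restrict (\<lambda>x. fst (f x)) (pverts X)"
    have "fst (f x) \<in> pverts F" if "x \<in> pverts X" for x
    proof -
      have "(fst (f x), snd (f x)) \<in> pverts (cfi F W)" using f that by (auto simp: graph_homs_def)
      then show ?thesis by (simp only: pverts_cfi)
    qed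
    moreover have "(fst (f x), fst (f y)) \<in> parcs F" if "(x, y) \<in> parcs X" for x y
    proof -
      have "((fst (f x), snd (f x)), (fst (f y), snd (f y))) \<in> parcs (cfi F W)"
        using f that by (auto simp: graph_homs_def)
      then show ?thesis by (simp only: parcs_cfi)
    qed
    ultimately have "?h \<in> graph_homs X F" using XV by (auto simp: graph_homs_def)
    moreover have "f \<in> lifts X F W ?h" using f by (auto simp: lifts_def)
    ultimately show "f \<in> (\<Union>h\<in>graph_homs X F. lifts X F W h)" by blast
  qed (auto simp: lifts_def)
  moreover have "lifts X F W h \<inter> lifts X F W h' = {}"
    if hh: "h \<in> graph_homs X F" "h' \<in> graph_homs X F" "h \<noteq> h'" for h h'
  proof (rule ccontr)
    assume "\<not> ?thesis"
    then have "\<forall>x\<in>pverts X. h x = h' x" unfolding lifts_def by force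
    then have "h = h'" using hh(1,2) by (intro extensionalityI[of h "pverts X" h'])
        (auto simp: graph_homs_def PiE_iff)
    then show False using hh(3) by simp
  qed
  moreover have "finite (graph_homs X F)"
    using X F by (intro finite_graph_homs) (auto simp: pair_graph_iff)
  ultimately show ?thesis
    unfolding hom_count_def using finite_lifts[OF X F] by (simp add: card_UN_disjoint)
qed

text \<open>Adding the fixed solution \<open>f0\<close>, by symmetric difference at every vertex, is
  injective and adds the right-hand sides.\<close>

lemma card_lifts_le:
  assumes X: "pair_graph X" and F: "pair_graph F" and h: "h \<in> graph_homs X F"
    and f0: "f0 \<in> lifts X F W0 h"
  shows "card (lifts X F W h) \<le> card (lifts X F (sym_diff W W0) h)"
proof (rule card_inj_on_le)
  let ?add = "\<lambda>f. restrict (\<lambda>x. (h x, sym_diff (snd (f x)) (snd (f0 x)))) (pverts X)"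
  note iff = lifts_iff[OF X h]
  show "finite (lifts X F (sym_diff W W0) h)" by (rule finite_lifts[OF X F])
  show "inj_on ?add (lifts X F W h)"
  proof (rule inj_onI)
    fix f g assume fg: "f \<in> lifts X F W h" "g \<in> lifts X F W h" "?add f = ?add g"
    show "f = g"
    proof (rule extensionalityI[of f "pverts X" g])
      fix x assume x: "x \<in> pverts X"
      have "sym_diff (snd (f x)) (snd (f0 x)) = sym_diff (snd (g x)) (snd (f0 x))"
        using fun_cong[OF fg(3), of x] x by simp
      then have "snd (f x) = snd (g x)" by blast
      moreover have "fst (f x) = fst (g x)" using fg(1,2) x by (simp add: lifts_def)
      ultimately show "f x = g x" by (rule prod_eqI[rotated])
    qed (use fg iff in auto)
  qed
  show "?add ` lifts X F W h \<subseteq> lifts X F (sym_diff W W0) h"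
  proof (intro image_subsetI)
    fix f assume f: "f \<in> lifts X F W h"
    have finN: "finite (parcs F `` {u})" for u
      using F finite_subset[of "parcs F" "pverts F \<times> pverts F"]
      by (auto simp: pair_graph_iff intro!: finite_Image)
    have fin: "finite (snd (g x))" if "g \<in> lifts X F W' h" "x \<in> pverts X" for g x W'
      using that finN finite_subset unfolding iff by metis
    have "odd (card (sym_diff (snd (f x)) (snd (f0 x)))) \<longleftrightarrow> h x \<in> sym_diff W W0"
      if "x \<in> pverts X" for x
      using odd_card_sym_diff[OF fin[OF f that] fin[OF f0 that]] f f0 that unfolding iff by auto
    moreover have "x \<in> pverts X" "y \<in> pverts X" if "(x, y) \<in> parcs X" for x y
      using X that by (auto simp: pair_graph_iff)
    ultimately show "?add f \<in> lifts X F (sym_diff W W0) h"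
      using f f0 unfolding iff by (auto 0 3)
  qed
qed

text \<open>The empty sets form the zero solution of the homogeneous system.\<close>

lemma lifts_untwisted_nonempty:
  assumes "pair_graph X" "h \<in> graph_homs X F"
  shows "lifts X F {} h \<noteq> {}"
proof -
  have "restrict (\<lambda>x. (h x, {})) (pverts X) \<in> lifts X F {} h"
    unfolding lifts_iff[OF assms] using assms(1) by (auto simp: pair_graph_iff)
  then show ?thesis by blast
qed

text \<open>Translation by one lift with twist W leads from twist W to the empty twist and back,
  since W + W = 0.\<close>

lemma card_lifts_eq:
  assumes "pair_graph X" "pair_graph F" "h \<in> graph_homs X F" "lifts X F W h \<noteq> {}"
  shows "card (lifts X F W h) = card (lifts X F {} h)"
proof -
  obtain f0 where "f0 \<in> lifts X F W h" using assms(4) by blast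
  from card_lifts_le[OF assms(1-3) this, of W] card_lifts_le[OF assms(1-3) this, of "{}"]
  show ?thesis by simp
qed

text \<open>The order of the type only selects one orientation of each edge.\<close>

lemma even_card_sym_irrefl:
  fixes D :: "'a :: linorder rel"
  assumes "finite D" "sym D" "irrefl D"
  shows "even (card D)"
proof -
  define L where "L = {(x, y) \<in> D. x < y}"
  have D: "D = L \<union> L\<inverse>"
    using assms(2,3) by (auto simp: L_def irrefl_def sym_def) (metis linorder_neqE)
  have "finite L" using assms(1) by (rule rev_finite_subset) (auto simp: L_def)
  moreover have "L \<inter> L\<inverse> = {}" by (auto simp: L_def)
  ultimately have "card (L \<union> L\<inverse>) = card L + card (L\<inverse>)"
    by (intro card_Un_disjoint) auto
  then show ?thesis unfolding D by (simp add: card_inverse)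
qed

text \<open>The sets \<open>snd (f x)\<close> are the neighbourhoods of a subgraph of F in which v
  alone has odd degree, contrary to the handshake lemma.\<close>

lemma no_twisted_lift_of_id:
  fixes F :: "'a :: linorder pair_pre_digraph"
  assumes F: "pair_graph F" and v: "v \<in> pverts F"
  shows "lifts F F {v} (restrict id (pverts F)) = {}"
proof (rule ccontr)
  let ?h = "restrict id (pverts F)" and ?V = "pverts F"
  have FV: "finite ?V" "parcs F \<subseteq> ?V \<times> ?V" "irrefl (parcs F)"
    using F by (auto simp: pair_graph_iff)
  have h: "?h \<in> graph_homs F F" using FV by (auto simp: graph_homs_def)
  assume "\<not> ?thesis"
  then obtain f where f: "f \<in> lifts F F {v} ?h" by blast
  let ?D = "SIGMA x:?V. snd (f x)"
  have S: "snd (f x) \<subseteq> parcs F `` {x}" "odd (card (snd (f x))) \<longleftrightarrow> x = v" if "x \<in> ?V" for x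
    using f that unfolding lifts_iff[OF F h] by auto
  have symS: "y \<in> snd (f x) \<longleftrightarrow> x \<in> snd (f y)" if "(x, y) \<in> parcs F" for x y
    using f that FV unfolding lifts_iff[OF F h] by fastforce
  have D: "?D \<subseteq> parcs F" using S by blast
  then have "sym ?D" using symS FV by (blast intro: symI)
  moreover have finD: "finite ?D" using D FV by (meson finite_SigmaI finite_subset)
  moreover have "irrefl ?D" using D FV by (auto simp: irrefl_def)
  ultimately have ev: "even (card ?D)" using even_card_sym_irrefl by blast
  have "finite (snd (f x))" if "x \<in> ?V" for x
    using S(1)[OF that] FV by (meson finite_Image finite_SigmaI finite_subset)
  then have "card ?D = (\<Sum>x\<in>?V. card (snd (f x)))" using FV by (intro card_SigmaI) auto
  also have "\<dots> = card (snd (f v)) + (\<Sum>x\<in>?V - {v}. card (snd (f x)))"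
    using FV v by (simp add: sum.remove)
  finally have "odd (card ?D) \<longleftrightarrow> odd (card (snd (f v)) + (\<Sum>x\<in>?V - {v}. card (snd (f x))))" by simp
  moreover have "even (\<Sum>x\<in>?V - {v}. card (snd (f x)))" using S by (intro dvd_sum) auto
  ultimately show False using ev S(2)[OF v] by simp
qed

text \<open>The counts are compared fibre by fibre: a twisted fibre is empty or as large as the
  untwisted one, and over the identity it is empty while the untwisted one is not.\<close>

lemma hom_count_cfi_strict:
  fixes F :: "'a :: linorder pair_pre_digraph"
  assumes F: "pair_graph F" and v: "v \<in> pverts F"
  shows "hom_count F (cfi F {v}) < hom_count F (cfi F {})"
  unfolding hom_count_cfi[OF F F]
proof (rule sum_strict_mono_ex1)
  let ?h = "restrict id (pverts F)"
  show "finite (graph_homs F F)" using F by (intro finite_graph_homs) (auto simp: pair_graph_iff)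
  show "\<forall>h\<in>graph_homs F F. card (lifts F F {v} h) \<le> card (lifts F F {} h)"
  proof
    fix h assume "h \<in> graph_homs F F"
    then show "card (lifts F F {v} h) \<le> card (lifts F F {} h)"
      using card_lifts_eq[OF F F, of h "{v}"] by (cases "lifts F F {v} h = {}") auto
  qed
  have h: "?h \<in> graph_homs F F" using F by (auto simp: graph_homs_def pair_graph_iff)
  then have "0 < card (lifts F F {} ?h)"
    using lifts_untwisted_nonempty[OF F h] finite_lifts[OF F F] by (simp add: card_gt_0_iff)
  then show "\<exists>h\<in>graph_homs F F. card (lifts F F {v} h) < card (lifts F F {} h)"
    using h no_twisted_lift_of_id[OF F v] by (intro bexI[of _ ?h]) auto
qed

text \<open>CFI graphs have pairs of a vertex and a vertex set as vertices, whereas the closure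
  property asks for graphs on \<open>nat\<close>; finiteness supplies an injective renaming.\<close>

lemma ngraph_copy:
  fixes G :: "'a pair_pre_digraph"
  assumes G: "pair_graph G"
  shows "\<exists>G' :: ngraph. pair_graph G' \<and> (\<forall>F :: ngraph. pair_graph F \<longrightarrow> hom_count F G' = hom_count F G)"
proof -
  have GV: "finite (pverts G)" "parcs G \<subseteq> pverts G \<times> pverts G" "sym (parcs G)" "irrefl (parcs G)"
    using G by (auto simp: pair_graph_iff)
  obtain \<phi> :: "'a \<Rightarrow> nat" where inj: "inj_on \<phi> (pverts G)"
    using finite_imp_inj_to_nat_seg[OF GV(1)] by blast
  define G' where "G' = \<lparr>pverts = \<phi> ` pverts G, parcs = map_prod \<phi> \<phi> ` parcs G\<rparr>"
  have arcs: "(\<phi> x, \<phi> y) \<in> parcs G' \<longleftrightarrow> (x, y) \<in> parcs G" if "x \<in> pverts G" "y \<in> pverts G" for x y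
  proof
    assume "(\<phi> x, \<phi> y) \<in> parcs G'"
    then obtain x' y' where xy: "(x', y') \<in> parcs G" "\<phi> x' = \<phi> x" "\<phi> y' = \<phi> y"
      by (auto simp: G'_def)
    then have "x' = x" "y' = y" using that GV(2) inj_onD[OF inj] by blast+
    then show "(x, y) \<in> parcs G" using xy by simp
  qed (auto simp: G'_def intro: rev_image_eqI)
  have "pair_graph G'"
    unfolding pair_graph_iff
  proof (intro conjI)
    show "sym (parcs G')" using GV(3) by (force simp: G'_def sym_def)
    show "irrefl (parcs G')"
      using GV(2,4) inj by (auto simp: G'_def irrefl_def dest: inj_onD)
  qed (use GV in \<open>auto simp: G'_def\<close>)
  moreover have "hom_count F G' = hom_count F G" if F: "pair_graph F" for F :: ngraph
  proof -
    have FV: "x \<in> pverts F" "y \<in> pverts F" if "(x, y) \<in> parcs F" for x y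
      using F that by (auto simp: pair_graph_iff)
    have "bij_betw (\<lambda>f. restrict (\<phi> \<circ> f) (pverts F)) (graph_homs F G) (graph_homs F G')"
    proof (rule bij_betw_byWitness[where f' = "\<lambda>g. restrict (inv_into (pverts G) \<phi> \<circ> g) (pverts F)"])
      show "\<forall>f\<in>graph_homs F G.
          restrict (inv_into (pverts G) \<phi> \<circ> restrict (\<phi> \<circ> f) (pverts F)) (pverts F) = f"
        using inj by (auto simp: graph_homs_def PiE_iff extensional_def fun_eq_iff Pi_iff)
      show "\<forall>g\<in>graph_homs F G'.
          restrict (\<phi> \<circ> restrict (inv_into (pverts G) \<phi> \<circ> g) (pverts F)) (pverts F) = g"
        by (auto simp: graph_homs_def PiE_iff extensional_def fun_eq_iff Pi_iff G'_def f_inv_into_f)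
      show "(\<lambda>f. restrict (\<phi> \<circ> f) (pverts F)) ` graph_homs F G \<subseteq> graph_homs F G'"
      proof (intro image_subsetI)
        fix f assume f: "f \<in> graph_homs F G"
        then have fV: "f x \<in> pverts G" if "x \<in> pverts F" for x using that by (auto simp: graph_homs_def)
        then have "\<phi> (f x) \<in> pverts G'" if "x \<in> pverts F" for x using that by (auto simp: G'_def)
        then show "restrict (\<phi> \<circ> f) (pverts F) \<in> graph_homs F G'"
          using f FV fV arcs by (auto simp: graph_homs_def)
      qed
      show "(\<lambda>g. restrict (inv_into (pverts G) \<phi> \<circ> g) (pverts F)) ` graph_homs F G' \<subseteq> graph_homs F G"
      proof (intro image_subsetI)
        fix g assume g: "g \<in> graph_homs F G'"
        let ?g = "\<lambda>x. inv_into (pverts G) \<phi> (g x)"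
        have gV: "?g x \<in> pverts G" "\<phi> (?g x) = g x" if "x \<in> pverts F" for x
        proof -
          have "g x \<in> \<phi> ` pverts G" using g that by (auto simp: graph_homs_def G'_def)
          then show "?g x \<in> pverts G" "\<phi> (?g x) = g x" by (auto intro: inv_into_into f_inv_into_f)
        qed
        have "(?g x, ?g y) \<in> parcs G" if "(x, y) \<in> parcs F" for x y
          using arcs[of "?g x" "?g y"] gV FV[OF that] g that by (auto simp: graph_homs_def)
        then show "restrict (inv_into (pverts G) \<phi> \<circ> g) (pverts F) \<in> graph_homs F G"
          using FV gV by (auto simp: graph_homs_def)
      qed
    qed
    then show ?thesis by (simp add: hom_count_def bij_betw_same_card)
  qed
  ultimately show ?thesis by blast
qed

section \<open>Twisted lifts over a tree decomposition\<close>

text \<open>Node t receives an edge set \<open>D t\<close> with boundary v + r t. For x in bag t the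
  lift takes the edges of \<open>D t\<close> at h x. Their number is odd exactly if h x = v, because
  r t lies outside the image of the bag; along an edge of X both ends agree because
  \<open>D t\<close> is symmetric.\<close>

lemma twisted_lift_exists:
  fixes X :: "'a pair_pre_digraph" and F :: "'b pair_pre_digraph"
  assumes X: "pair_graph X" and F: "pair_graph F" and td: "tree_decomposition X T \<beta>"
    and width: "td_width T \<beta> \<le> int k" and adh: "td_adhesion T \<beta> \<le> 2" and k: "1 \<le> k"
    and B: "B \<subseteq> pverts F" "k + 2 \<le> card B" "inseparable (min k 2) (parcs F) B"
    and v: "v \<in> B" and h: "h \<in> graph_homs X F"
  shows "lifts X F {v} h \<noteq> {}"
proof -
  let ?E = "parcs F"
  have XV: "x \<in> pverts X" "y \<in> pverts X" if "(x, y) \<in> parcs X" for x y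
    using X that by (auto simp: pair_graph_iff)
  have FV: "finite (pverts F)" "?E \<subseteq> pverts F \<times> pverts F" "sym ?E" "irrefl ?E"
    using F by (auto simp: pair_graph_iff)
  have finE: "finite ?E" using FV by (meson finite_SigmaI finite_subset)
  have tree: "undirected_tree T" and UT: "(\<Union>t\<in>pverts T. \<beta> t) = pverts X"
    and edge: "\<And>u v. (u, v) \<in> parcs X \<Longrightarrow> \<exists>t\<in>pverts T. u \<in> \<beta> t \<and> v \<in> \<beta> t"
    and sub: "\<And>v. v \<in> pverts X \<Longrightarrow> connected (with_proj T \<restriction> {t \<in> pverts T. v \<in> \<beta> t})"
    using td unfolding tree_decomposition_def by blast+
  have TG: "pair_graph T" using tree by (simp add: undirected_tree_def)
  have TV: "finite (pverts T)" "parcs T \<subseteq> pverts T \<times> pverts T" "sym (parcs T)"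
    using TG by (auto simp: pair_graph_iff)
  have finb: "finite (\<beta> t)" if "t \<in> pverts T" for t
    using X UT that finite_subset[of "\<beta> t" "pverts X"] by (auto simp: pair_graph_iff)
  have cb: "card (\<beta> t) \<le> k + 1" if "t \<in> pverts T" for t
  proof -
    have "int (card (\<beta> t)) \<le> Max ((\<lambda>t. int (card (\<beta> t))) ` pverts T)"
      using TV(1) that by (intro Max_ge) auto
    then show ?thesis using width by (simp add: td_width_def)
  qed
  have ca: "card (\<beta> s \<inter> \<beta> t) \<le> 2" if "(s, t) \<in> parcs T" for s t
  proof -
    have "finite (parcs T)" using TV by (meson finite_SigmaI finite_subset)
    then have "card (\<beta> s \<inter> \<beta> t) \<le> td_adhesion T \<beta>"
      unfolding td_adhesion_def using that by (intro Max_ge) force+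
    then show ?thesis using adh by simp
  qed
  \<comment> \<open>The choice depends on the image of the bag alone, so that bags with equal images
    receive the same r; the case k = 1 relies on this.\<close>
  define \<rho> where "\<rho> = (\<lambda>U. SOME r. r \<in> B - U)"
  define r where "r = (\<lambda>t. \<rho> (h ` \<beta> t))"
  have r: "r t \<in> B" "r t \<notin> h ` \<beta> t" if "t \<in> pverts T" for t
  proof -
    have "card (h ` \<beta> t) \<le> k + 1" using card_image_le[OF finb] cb that by (meson le_trans)
    then have "\<not> B \<subseteq> h ` \<beta> t" using B(2) card_mono[of "h ` \<beta> t" B] finb that by fastforce
    then have "\<exists>r. r \<in> B - h ` \<beta> t" by blast
    then have "r t \<in> B - h ` \<beta> t" unfolding r_def \<rho>_def by (rule someI_ex)
    then show "r t \<in> B" "r t \<notin> h ` \<beta> t" by auto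
  qed
  have chain: "\<exists>C. path_chain (Restr ?E (- A)) s t C"
    if "finite A" "card A \<le> min k 2" "s \<in> B - A" "t \<in> B - A" for A s t
  proof (rule path_chain_exists)
    show "(s, t) \<in> (Restr ?E (- A))\<^sup>*" by (rule inseparableD[OF B(3) that])
  qed (use finE FV in \<open>auto simp: sym_def irrefl_def\<close>)
  \<comment> \<open>\<open>R\<close> asks that the edge sets of adjacent nodes give the same value
    on every common vertex of their bags.\<close>
  define R where "R = (\<lambda>s t (D :: 'b rel) (C :: 'b rel). \<forall>x\<in>\<beta> s \<inter> \<beta> t. D `` {h x} = C `` {h x})"
  have step: "\<exists>D'. path_chain ?E v (r t) D' \<and> R s t D D'"
    if st: "(s, t) \<in> parcs T" and D: "path_chain ?E v (r s) D" for s t D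
  proof -
    have s: "s \<in> pverts T" and t: "t \<in> pverts T" using st TV by auto
    let ?A = "h ` (\<beta> s \<inter> \<beta> t)"
    have finA: "finite ?A" using finb s by auto
    have cA: "card ?A \<le> 2"
      using ca[OF st] card_image_le[of "\<beta> s \<inter> \<beta> t" h] finb[OF s] by (meson finite_Int le_trans)
    show ?thesis
    proof (cases "card ?A \<le> min k 2")
      case True
      \<comment> \<open>Both r s and r t lie in B outside \<open>?A\<close>, so inseparability joins
        them by a path avoiding \<open>?A\<close>. Adding its edges changes no edge at
        \<open>?A\<close>.\<close>
      then obtain C where C: "path_chain (Restr ?E (- ?A)) (r s) (r t) C"
        using chain[OF finA] r[OF s] r[OF t] by blast
      then have "path_chain ?E (r s) (r t) C" by (auto simp: path_chain_def)
      then have "path_chain ?E v (r t) (sym_diff D C)" using path_chain_add[OF finE D] by blast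
      moreover have "R s t D (sym_diff D C)" using C unfolding R_def path_chain_def by blast
      ultimately show ?thesis by blast
    next
      case False
      \<comment> \<open>For k = 1 the image \<open>?A\<close> can have two vertices, one more than
        the order of inseparability allows. But then bags have at most two vertices, so both bags
        have the image \<open>?A\<close>; hence r s = r t and D can be kept.\<close>
      then have k1: "k = 1" "card ?A = 2" using cA k by (auto simp: min_def split: if_splits)
      have "?A = h ` \<beta> u" if "u \<in> pverts T" "?A \<subseteq> h ` \<beta> u" for u
        using that k1 cb[OF that(1)] card_image_le[OF finb[OF that(1)], of h] finb
        by (intro card_seteq) auto
      then have "r s = r t" unfolding r_def using s t by (metis Int_lower1 Int_lower2 image_mono)
      then show ?thesis using D by (intro exI[of _ D]) (auto simp: R_def)
    qed
  qed
  obtain t0 where t0: "t0 \<in> pverts T"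
    using tree connected_with_proj_iff[OF TG] unfolding undirected_tree_def by blast
  obtain D0 where D0: "path_chain ?E v (r t0) D0"
    using chain[of "{}" v "r t0"] v r[OF t0] by auto
  have "\<exists>D. (\<forall>t\<in>pverts T. path_chain ?E v (r t) (D t)) \<and> (\<forall>(s, t)\<in>parcs T. R s t (D s) (D t))"
    by (rule undirected_tree_propagate[where good = "\<lambda>t. path_chain ?E v (r t)" and R = R,
          OF tree t0 D0 step]) (auto simp: R_def)
  then obtain D where D: "\<And>t. t \<in> pverts T \<Longrightarrow> path_chain ?E v (r t) (D t)"
      "\<And>s t. (s, t) \<in> parcs T \<Longrightarrow> R s t (D s) (D t)"
    by blast
  \<comment> \<open>The nodes whose bags contain x are connected, so agreement across single arcs
    makes the value at x independent of the bag.\<close>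
  have agree: "D s `` {h x} = D t `` {h x}"
    if x: "x \<in> \<beta> s" "x \<in> \<beta> t" and st: "s \<in> pverts T" "t \<in> pverts T" for x s t
  proof -
    let ?S = "{t \<in> pverts T. x \<in> \<beta> t}"
    have "x \<in> pverts X" using x st UT by blast
    then have "?S \<times> ?S \<subseteq> (Restr (parcs T) ?S)\<^sup>*"
      using sub connected_induce_iff[OF TV(3), THEN iffD1, THEN conjunct2] by simp
    then have "(s, t) \<in> (Restr (parcs T) ?S)\<^sup>*" using x st by blast
    then show ?thesis
      by (induction rule: rtrancl_induct) (use D(2) in \<open>auto simp: R_def\<close>)
  qed
  have "\<forall>x\<in>pverts X. \<exists>t. t \<in> pverts T \<and> x \<in> \<beta> t" using UT by blast
  then obtain \<tau> where \<tau>: "\<And>x. x \<in> pverts X \<Longrightarrow> \<tau> x \<in> pverts T \<and> x \<in> \<beta> (\<tau> x)" by metis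
  let ?f = "restrict (\<lambda>x. (h x, D (\<tau> x) `` {h x})) (pverts X)"
  have "?f \<in> lifts X F {v} h"
    unfolding lifts_iff[OF X h]
  proof (intro conjI ballI)
    fix x assume x: "x \<in> pverts X"
    then have c: "path_chain ?E v (r (\<tau> x)) (D (\<tau> x))" and "h x \<noteq> r (\<tau> x)"
      using D(1) \<tau>[OF x] r(2)[of "\<tau> x"] by (auto dest: sym)
    then show "odd (card (snd (?f x))) \<longleftrightarrow> h x \<in> {v}" using x by (simp add: path_chain_def)
    show "snd (?f x) \<subseteq> ?E `` {h x}" using x c by (auto simp: path_chain_def)
    show "fst (?f x) = h x" using x by simp
  next
    fix e assume e: "e \<in> parcs X"
    obtain x y where xy: "e = (x, y)" by (cases e)
    then obtain t where t: "t \<in> pverts T" "x \<in> \<beta> t" "y \<in> \<beta> t" using edge e by blast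
    have x: "x \<in> pverts X" and y: "y \<in> pverts X" using XV e xy by auto
    have "snd (?f x) = D t `` {h x}" "snd (?f y) = D t `` {h y}"
      using agree[of x "\<tau> x" t] agree[of y "\<tau> y" t] t \<tau>[OF x] \<tau>[OF y] x y by auto
    moreover have "sym (D t)" using D(1)[OF t(1)] by (simp add: path_chain_def)
    ultimately have "h y \<in> snd (?f x) \<longleftrightarrow> h x \<in> snd (?f y)" by (auto dest: symD)
    then show "case e of (x, y) \<Rightarrow> h y \<in> snd (?f x) \<longleftrightarrow> h x \<in> snd (?f y)" using xy by simp
  qed simp
  then show ?thesis by blast
qed

section \<open>The closure theorem\<close>

theorem theorem4p13:
  fixes k :: nat
  assumes "k \<ge> 1"
  shows "hom_distinguishing_closed (td_class k 2)"
  unfolding hom_distinguishing_closed_def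
proof (intro allI impI, elim conjE)
  fix F :: ngraph assume F: "pair_graph F" and notin: "F \<notin> td_class k 2"
  obtain B where B: "B \<subseteq> pverts F" "k + 2 \<le> card B" "inseparable (min k 2) (parcs F) B"
    using inseparable_of_not_in_td_class[OF F notin] .
  then obtain v where v: "v \<in> B" by fastforce
  \<comment> \<open>G is a copy of the untwisted and H of the twisted CFI graph of F.\<close>
  obtain G :: ngraph where G: "pair_graph G"
      "\<And>X :: ngraph. pair_graph X \<Longrightarrow> hom_count X G = hom_count X (cfi F {})"
    using ngraph_copy[OF pair_graph_cfi[OF F]] by blast
  obtain H :: ngraph where H: "pair_graph H"
      "\<And>X :: ngraph. pair_graph X \<Longrightarrow> hom_count X H = hom_count X (cfi F {v})"
    using ngraph_copy[OF pair_graph_cfi[OF F]] by blast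
  have indist: "hom_count X G = hom_count X H" if "X \<in> td_class k 2" for X
  proof -
    from that obtain T :: ngraph and \<beta> where X: "pair_graph X" and td: "tree_decomposition X T \<beta>"
        "td_width T \<beta> \<le> int k" "td_adhesion T \<beta> \<le> 2"
      unfolding td_class_def by blast
    \<comment> \<open>Over every h the twisted system is solvable, so the two fibres have equal
      size.\<close>
    have "card (lifts X F {} h) = card (lifts X F {v} h)" if "h \<in> graph_homs X F" for h
      using card_lifts_eq[OF X F that twisted_lift_exists[OF X F td assms B v that]] by simp
    then show ?thesis unfolding G(2)[OF X] H(2)[OF X] hom_count_cfi[OF X F] by (rule sum.cong[OF refl])
  qed
  have diff: "hom_count F G \<noteq> hom_count F H"
    using hom_count_cfi_strict[OF F, of v] v B(1) unfolding G(2)[OF F] H(2)[OF F] by auto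
  have "hom_indistinguishable (td_class k 2) G H"
    unfolding hom_indistinguishable_def using indist by (rule ballI)
  then show "\<exists>G H. pair_graph G \<and> pair_graph H \<and> hom_indistinguishable (td_class k 2) G H \<and>
      hom_count F G \<noteq> hom_count F H"
    using G(1) H(1) diff by (intro exI conjI)
qed

end
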